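(* Let $d\ge 3$ be a fixed integer. For each $n$, let $S_n$ be the size of a uniformly random strict $(n,dn+1)$-core partition. Then $S_n$ is asymptotically normal as $n\to\infty$, i.e. $(S_n-\mathbb{E}[S_n])/\sqrt{\mathrm{Var}(S_n)}$ converges in distribution to the standard normal distribution $\mathcal{N}(0,1)$.
   Context: A partition is a finite non-increasing sequence of positive integers $\lambda=(\lambda_1\ge\cdots\ge\lambda_\ell>0)$; the empty partition is allowed. Its size is $|\lambda|=\sum_i\lambda_i$; it is strict if $\lambda_1>\lambda_2>\cdots>\lambda_\ell$. Its Young diagram is the left-justified array with $\lambda_i$ boxes in row $i$; the hook length of a box is the number of boxes directly to its right or directly below it, plus one for the box itself. A partition is an $s$-core if none of its hook lengths is a multiple of $s$, and an $(s,t)$-core if it is both an $s$-core and a $t$-core. For coprime $s,t$ there are only finitely many $(s,t)$-core partitions, so the uniform distribution on strict $(n,dn+1)$-core partitions is well defined. *)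

theory Defs
  imports "HOL-Probability.Probability"
begin

text \<open>
  A partition is represented by the list of its parts in non-increasing order; the size of a
  partition is \<^const>\<open>sum_list\<close>. Rows and columns of the Young diagram are counted from 0.
\<close>

definition partition :: "nat list \<Rightarrow> bool" where
  "partition xs \<longleftrightarrow> sorted_wrt (\<ge>) xs \<and> (\<forall>x \<in> set xs. 0 < x)"

definition strict_partition :: "nat list \<Rightarrow> bool" where
  "strict_partition xs \<longleftrightarrow> partition xs \<and> sorted_wrt (>) xs"

definition young_diagram :: "nat list \<Rightarrow> (nat \<times> nat) set" where
  "young_diagram xs = {(i, j). i < length xs \<and> j < xs ! i}"

definition hook_length :: "nat list \<Rightarrow> nat \<times> nat \<Rightarrow> nat" where
  "hook_length xs = (\<lambda>(i, j).
     card {j'. j < j' \<and> (i, j') \<in> young_diagram xs}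
     + card {i'. i < i' \<and> (i', j) \<in> young_diagram xs} + 1)"

definition core :: "nat \<Rightarrow> nat list \<Rightarrow> bool" where
  "core s xs \<longleftrightarrow> partition xs \<and> (\<forall>b \<in> young_diagram xs. \<not> s dvd hook_length xs b)"

definition strict_cores :: "nat \<Rightarrow> nat \<Rightarrow> nat list set" where
  "strict_cores s t = {xs. strict_partition xs \<and> core s xs \<and> core t xs}"

text \<open>
  The uniform distribution on \<^term>\<open>strict_cores s t\<close>. It is meaningful when this set is
  finite, in particular for coprime \<open>s\<close> and \<open>t\<close>; the set always contains the empty partition.
\<close>

definition random_strict_core :: "nat \<Rightarrow> nat \<Rightarrow> nat list pmf" where
  "random_strict_core s t = pmf_of_set (strict_cores s t)"

text \<open>
  Asymptotic normality of a sequence of random variables \<open>X n\<close> on discrete probability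
  spaces \<open>P n\<close>. Where the variance vanishes, division by zero yields the constant 0, which
  is harmless if this happens for only finitely many \<open>n\<close>.
\<close>

definition asymptotically_normal :: "(nat \<Rightarrow> 'a pmf) \<Rightarrow> (nat \<Rightarrow> 'a \<Rightarrow> real) \<Rightarrow> bool" where
  "asymptotically_normal P X \<longleftrightarrow>
     weak_conv_m
       (\<lambda>n. distr (measure_pmf (P n)) borel
          (\<lambda>x. (X n x - measure_pmf.expectation (P n) (X n))
                 / sqrt (measure_pmf.variance (P n) (X n))))
       std_normal_distribution"

end

theory Submission
  imports Defs "HOL-Complex_Analysis.Complex_Analysis"
begin

text \<open>
  The beta-set (set of first-column hook lengths) of a strict \<open>(n, dn + 1)\<close>-core contains, in each
  residue class \<open>i\<close> modulo \<open>n\<close>, an initial segment \<open>i, i + n, \<dots>\<close> of some length \<open>a\<^sub>i\<close>. Strictness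
  forbids consecutive elements, and together with the second core condition this means exactly that
  \<open>a\<^sub>0 = 0\<close>, that \<open>a\<^sub>i \<le> d\<close>, and that no two adjacent \<open>a\<^sub>i\<close> are both non-zero
  (\<open>strict_cores_encoding\<close>). In these terms, with \<open>l = \<Sum> a\<^sub>i\<close>, the size is
  \<open>\<Sum> (i a\<^sub>i + n a\<^sub>i (a\<^sub>i - 1) / 2) - l (l - 1) / 2\<close>.

  For an additive statistic \<open>Y = \<Sum> g\<^sub>i(a\<^sub>i)\<close> the sums \<open>Z\<^sub>k(z)\<close> of \<open>exp (z Y)\<close> satisfy the hard-core
  recursion \<open>Z\<^sub>k = Z\<^sub>k\<^sub>-\<^sub>1 + w\<^sub>k(z) Z\<^sub>k\<^sub>-\<^sub>2\<close> with \<open>w\<^sub>k(z) = \<Sum>u=1..d. exp (z g\<^sub>k(u))\<close>. When all \<open>w\<^sub>k(z)\<close> are close to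
  \<open>d\<close>, the quotients \<open>Z\<^sub>k / Z\<^sub>k\<^sub>-\<^sub>1\<close> stay in a fixed bounded part of a right half-plane
  (\<open>hard_core_ratio\<close>). If the \<open>g\<^sub>i(u)\<close> are bounded by \<open>M\<close>, the logarithm of \<open>Z\<^sub>k\<close> is therefore
  holomorphic and of order \<open>k\<close> on a disc with radius of order \<open>1 / M\<close>, and Cauchy's inequalities give
  \<open>E exp (z (Y - E Y)) = exp (V z\<^sup>2 / 2 + O (k (M \<bar>z\<bar>)\<^sup>3))\<close> with \<open>V\<close> the variance of \<open>Y\<close>
  (\<open>lin_stat_moment_generating\<close>).

  Replacing \<open>l (l - 1) / 2\<close> by its linearization at the mean \<open>m\<close> of \<open>l\<close> turns the size into an additive
  statistic with contributions of order \<open>n\<close>, up to a constant and the error \<open>(l - m)\<^sup>2 / 2\<close>. For three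
  available values of \<open>a\<^sub>i\<close>, the term \<open>n a\<^sub>i (a\<^sub>i - 1) / 2\<close> has second difference \<open>n\<close>, so each
  occupied position contributes variance of order \<open>n\<^sup>2\<close> whatever the linear terms are, and \<open>V\<close> is of order at least \<open>n\<^sup>3\<close>
  (\<open>sum_power2_lin_stat_ge\<close>). At \<open>z = \<i> t / sqrt V\<close> the cubic error vanishes in the limit
  (\<open>lin_stat_char_limit\<close>). The mean square of \<open>(l - m)\<^sup>2 / 2\<close> is at most of order \<open>n\<^sup>2\<close>
  (\<open>length_fourth_moment\<close>), which is negligible against \<open>V\<close> both for the fluctuations and for the
  standard deviation used in the normalization (\<open>avg_iexp_standardized_diff_le\<close>). The theorem then
  follows from Levy's continuity theorem.
\<close>

section \<open>Beta-sets of strict partitions\<close>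

text \<open>
  The first-column hook lengths of a partition: with \<open>l\<close> parts, the part in row \<open>i\<close>, counted from 0,
  contributes itself plus \<open>l - 1 - i\<close>. A strict partition yields a set without 0 and without
  two consecutive elements, and every such finite set arises exactly once.
\<close>

fun beta_set :: "nat list \<Rightarrow> nat set" where
  "beta_set [] = {}"
| "beta_set (x # xs) = insert (x + length xs) (beta_set xs)"

lemma finite_beta_set [simp]: "finite (beta_set xs)"
  by (induction xs) auto

lemma partition_Cons: "partition (x # xs) \<longleftrightarrow> 0 < x \<and> (\<forall>y\<in>set xs. y \<le> x) \<and> partition xs"
  by (auto simp: partition_def)

lemma strict_partition_Cons:
  "strict_partition (x # xs) \<longleftrightarrow> 0 < x \<and> (\<forall>y\<in>set xs. y < x) \<and> strict_partition xs"
  by (auto simp: strict_partition_def partition_def less_imp_le)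

lemma strict_partition_imp_partition: "strict_partition xs \<Longrightarrow> partition xs"
  by (simp add: strict_partition_def)

lemma beta_set_less:
  assumes "\<forall>y\<in>set xs. y \<le> x" "b \<in> beta_set xs"
  shows "b < x + length xs"
  using assms by (induction xs) force+

lemma beta_set_less_strict:
  assumes "\<forall>y\<in>set xs. y < x" "b \<in> beta_set xs"
  shows "Suc b < x + length xs"
  using assms by (induction xs) force+

lemma beta_set_pos:
  assumes "partition xs" "b \<in> beta_set xs"
  shows "0 < b"
  using assms by (induction xs) (auto simp: partition_Cons)

lemma card_beta_set:
  assumes "partition xs"
  shows "card (beta_set xs) = length xs"
  using assms
proof (induction xs)
  case (Cons x xs)
  then have "x + length xs \<notin> beta_set xs"
    using beta_set_less[of xs x "x + length xs"] by (auto simp: partition_Cons)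
  then show ?case using Cons by (simp add: partition_Cons)
qed simp

lemma sum_beta_set:
  assumes "partition xs"
  shows "\<Sum>(beta_set xs) = sum_list xs + \<Sum>{..<length xs}"
  using assms
proof (induction xs)
  case (Cons x xs)
  then have "x + length xs \<notin> beta_set xs"
    using beta_set_less[of xs x "x + length xs"] by (auto simp: partition_Cons)
  then show ?case using Cons by (simp add: partition_Cons)
qed simp

lemma beta_set_no_consecutive:
  assumes "strict_partition xs" "b \<in> beta_set xs"
  shows "Suc b \<notin> beta_set xs"
  using assms
proof (induction xs arbitrary: b)
  case (Cons x xs)
  have *: "\<forall>y\<in>set xs. y < x" "strict_partition xs"
    using Cons.prems(1) by (auto simp: strict_partition_Cons)
  then have le: "\<forall>y\<in>set xs. y \<le> x" by auto
  show ?case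
    using Cons.IH[OF *(2)] Cons.prems(2) beta_set_less_strict[OF *(1)] beta_set_less[OF le]
    by (auto dest: Suc_lessD less_imp_neq)
qed simp

lemma beta_set_inj:
  assumes "partition xs" "partition ys" "beta_set xs = beta_set ys"
  shows "xs = ys"
proof -
  have "length xs = length ys"
    using assms card_beta_set by metis
  then show ?thesis using assms
  proof (induction xs ys rule: list_induct2)
    case (Cons x xs y ys)
    have lx: "b < x + length xs" if "b \<in> beta_set xs" for b
      using beta_set_less[of xs x b] that Cons.prems(1) by (simp add: partition_Cons)
    have ly: "b < y + length xs" if "b \<in> beta_set ys" for b
      using beta_set_less[of ys y b] that Cons.prems(2) Cons.hyps by (simp add: partition_Cons)
    have eq: "insert (x + length xs) (beta_set xs) = insert (y + length xs) (beta_set ys)"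
      using Cons.prems(3) Cons.hyps by simp
    have "x = y"
    proof (rule ccontr)
      assume "x \<noteq> y"
      then have "x + length xs \<in> beta_set ys" "y + length xs \<in> beta_set xs"
        using eq by (metis add_right_cancel insert_iff)+
      then show False using lx ly by force
    qed
    moreover have "beta_set xs = beta_set ys"
      using eq lx ly \<open>x = y\<close> by (metis insert_ident nat_neq_iff)
    ultimately show ?case using Cons by (simp add: partition_Cons)
  qed simp
qed

lemma beta_set_surj:
  assumes "finite B" "0 \<notin> B" "\<And>b. b \<in> B \<Longrightarrow> Suc b \<notin> B"
  shows "\<exists>xs. strict_partition xs \<and> beta_set xs = B"
  using assms
proof (induction B rule: finite_linorder_max_induct)
  case empty
  show ?case by (rule exI[of _ "[]"]) (simp add: strict_partition_def partition_def)
next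
  case (insert b B)
  then obtain xs where xs: "strict_partition xs" "beta_set xs = B"
    by auto
  show ?case
  proof (cases xs)
    case Nil
    then have "beta_set [b] = insert b B" "strict_partition [b]"
      using xs insert.prems by (auto simp: strict_partition_def partition_def)
    then show ?thesis by blast
  next
    case (Cons y ys)
    then have "y + length ys \<in> B" using xs by auto
    then have lt: "Suc (y + length ys) < b"
      using insert.hyps(2) insert.prems(2) by (metis Suc_lessI insertCI)
    define x where "x = b - length xs"
    have x: "y < x" "x + length xs = b" using lt Cons by (auto simp: x_def)
    have "z < x" if "z \<in> set xs" for z
      using that x(1) xs(1) Cons by (auto simp: strict_partition_Cons)
    then have "strict_partition (x # xs)" "beta_set (x # xs) = insert b B"
      using xs x by (auto simp: strict_partition_Cons)
    then show ?thesis by blast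
  qed
qed

section \<open>Hook lengths and cores\<close>

text \<open>
  The number of parts exceeding \<open>j\<close>, that is, the length of column \<open>j\<close> of the Young diagram
  (columns counted from 0).
\<close>

definition count_gt :: "nat list \<Rightarrow> nat \<Rightarrow> nat" where
  "count_gt xs j = card {i. i < length xs \<and> j < xs ! i}"

lemma count_gt_le_length: "count_gt xs j \<le> length xs"
proof -
  have "card {i. i < length xs \<and> j < xs ! i} \<le> card {..<length xs}"
    by (rule card_mono) auto
  then show ?thesis by (simp add: count_gt_def)
qed

lemma count_gt_antimono: "j \<le> j' \<Longrightarrow> count_gt xs j' \<le> count_gt xs j"
  unfolding count_gt_def by (rule card_mono) auto

lemma Collect_less_Suc_conv:
  "{i. i < Suc n \<and> P i} = (if P 0 then {0} else {}) \<union> Suc ` {i. i < n \<and> P (Suc i)}"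
  by (auto simp: image_iff less_Suc_eq_0_disj)

lemma count_gt_Cons: "count_gt (x # xs) j = (if j < x then 1 else 0) + count_gt xs j"
  unfolding count_gt_def length_Cons Collect_less_Suc_conv
  by (auto simp: card_image card_insert_if)

lemma count_gt_eq_0:
  assumes "\<forall>y\<in>set xs. y \<le> j"
  shows "count_gt xs j = 0"
proof -
  have "\<not> j < xs ! i" if "i < length xs" for i
    using assms nth_mem[OF that] by (simp add: linorder_not_less)
  then have "{i. i < length xs \<and> j < xs ! i} = {}" by blast
  then show ?thesis unfolding count_gt_def by (metis card.empty)
qed

text \<open>
  Column \<open>j\<close> of the Young diagram determines a gap of the beta-set. In a row whose beta-number
  is \<open>b\<close>, the hook length in column \<open>j\<close> is \<open>b\<close> minus this gap.
\<close>

lemma gap_notin_beta_set: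
  assumes "partition xs"
  shows "j + length xs - count_gt xs j \<notin> beta_set xs"
  using assms
proof (induction xs)
  case (Cons z zs)
  have IH: "j + length zs - count_gt zs j \<notin> beta_set zs" and le: "\<forall>y\<in>set zs. y \<le> z"
    using Cons by (auto simp: partition_Cons)
  show ?case
  proof (cases "j < z")
    case True
    then show ?thesis using IH count_gt_le_length[of zs j] by (auto simp: count_gt_Cons)
  next
    case False
    then have "count_gt (z # zs) j = 0"
      using le by (intro count_gt_eq_0) auto
    moreover have "b < Suc (j + length zs)" if "b \<in> beta_set (z # zs)" for b
      using beta_set_less[OF le, of b] that False by auto
    ultimately show ?thesis by fastforce
  qed
qed simp

text \<open>
  The gaps below the largest beta-number are exactly the numbers attached to the columns. One
  inclusion is the previous lemma; equality follows because both sides have as many elements as there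
  are columns.
\<close>

lemma first_row_gaps:
  assumes "partition (x # xs)"
  shows "(\<lambda>j. j + length xs - count_gt xs j) ` {..<x} = {y. y < x + length xs \<and> y \<notin> beta_set xs}"
    (is "?f ` _ = ?R")
proof (rule card_subset_eq)
  have p: "partition xs" and le: "\<forall>y\<in>set xs. y \<le> x"
    using assms by (auto simp: partition_Cons)
  show "finite ?R" by simp
  show "?f ` {..<x} \<subseteq> ?R"
  proof (rule image_subsetI, rule CollectI, rule conjI)
    fix j assume "j \<in> {..<x}"
    then show "?f j < x + length xs" by simp
    show "?f j \<notin> beta_set xs" by (rule gap_notin_beta_set[OF p])
  qed
  have "?f i < ?f j" if "i < j" for i j
    using that count_gt_antimono[of i j xs] count_gt_le_length[of xs i] by linarith
  then have "inj ?f" by (intro linorder_injI) (simp add: less_imp_neq)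
  then have "card (?f ` {..<x}) = x" by (subst card_image) (auto intro: inj_on_subset)
  moreover have "?R = {..<x + length xs} - beta_set xs" by auto
  moreover have "beta_set xs \<subseteq> {..<x + length xs}" using beta_set_less[OF le] by auto
  ultimately show "card (?f ` {..<x}) = card ?R"
    by (simp add: card_Diff_subset card_beta_set[OF p])
qed

lemma hook_length_Cons_Suc: "hook_length (x # xs) (Suc i, j) = hook_length xs (i, j)"
proof -
  have "{i'. Suc i < i' \<and> (i', j) \<in> young_diagram (x # xs)}
      = Suc ` {i'. i < i' \<and> (i', j) \<in> young_diagram xs}"
    by (auto simp: young_diagram_def image_iff gr0_conv_Suc Suc_less_eq2)
  then show ?thesis
    by (simp add: hook_length_def card_image) (simp add: young_diagram_def)
qed

lemma hook_length_Cons_0: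
  assumes "j < x"
  shows "hook_length (x # xs) (0, j) = x - j + count_gt xs j"
proof -
  have "{i'. 0 < i' \<and> (i', j) \<in> young_diagram (x # xs)} = Suc ` {i. i < length xs \<and> j < xs ! i}"
    by (auto simp: young_diagram_def image_iff gr0_conv_Suc)
  moreover have "{j'. j < j' \<and> (0, j') \<in> young_diagram (x # xs)} = {j<..<x}"
    by (auto simp: young_diagram_def)
  ultimately show ?thesis using assms
    by (simp add: hook_length_def card_image count_gt_def)
qed

lemma young_diagram_Cons:
  "young_diagram (x # xs) = Pair 0 ` {..<x} \<union> map_prod Suc id ` young_diagram xs"
proof -
  have "(i, j) \<in> young_diagram (x # xs) \<longleftrightarrow> (i, j) \<in> Pair 0 ` {..<x} \<union> map_prod Suc id ` young_diagram xs" for i j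
    by (cases i) (auto simp: young_diagram_def image_iff)
  then show ?thesis by auto
qed

text \<open>
  The condition on the beta-set \<open>B\<close> that makes a partition an \<open>s\<close>-core: every hook length is a
  difference \<open>b - y\<close> of an element \<open>b\<close> and a smaller non-element \<open>y\<close>, so none of these
  differences may be a multiple of \<open>s\<close>.
\<close>

definition core_set :: "nat \<Rightarrow> nat set \<Rightarrow> bool" where
  "core_set s B \<longleftrightarrow> (\<forall>b\<in>B. \<forall>y<b. s dvd b - y \<longrightarrow> y \<in> B)"

lemma core_iff_core_set:
  assumes "partition xs"
  shows "core s xs \<longleftrightarrow> core_set s (beta_set xs)"
  using assms
proof (induction xs)
  case Nil
  then show ?case by (simp add: core_def core_set_def young_diagram_def)
next
  case (Cons x xs)
  have p: "partition xs" and le: "\<forall>y\<in>set xs. y \<le> x"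
    using Cons.prems by (auto simp: partition_Cons)
  let ?n = "x + length xs"
  have "core s (x # xs) \<longleftrightarrow> (\<forall>j<x. \<not> s dvd x - j + count_gt xs j) \<and> core s xs"
  proof -
    have "hook_length (x # xs) (map_prod Suc id b) = hook_length xs b" for b
      by (cases b) (simp add: hook_length_Cons_Suc)
    then show ?thesis
      using Cons.prems p unfolding core_def young_diagram_Cons ball_Un ball_simps
      by (simp add: hook_length_Cons_0) blast
  qed
  also have "(\<forall>j<x. \<not> s dvd x - j + count_gt xs j) \<longleftrightarrow>
      (\<forall>y\<in>(\<lambda>j. j + length xs - count_gt xs j) ` {..<x}. \<not> s dvd ?n - y)"
  proof -
    have "?n - (j + length xs - count_gt xs j) = x - j + count_gt xs j" if "j < x" for j
      using that count_gt_le_length[of xs j] by linarith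
    then show ?thesis by simp blast
  qed
  also have "\<dots> \<longleftrightarrow> (\<forall>y<?n. s dvd ?n - y \<longrightarrow> y \<in> beta_set xs)"
    unfolding first_row_gaps[OF Cons.prems] by blast
  also have "\<dots> \<and> core s xs \<longleftrightarrow> core_set s (beta_set (x # xs))"
  proof -
    have "core_set s (beta_set (x # xs)) \<longleftrightarrow>
        (\<forall>y<?n. s dvd ?n - y \<longrightarrow> y \<in> insert ?n (beta_set xs)) \<and>
        (\<forall>b\<in>beta_set xs. \<forall>y<b. s dvd b - y \<longrightarrow> y \<in> insert ?n (beta_set xs))"
      by (simp add: core_set_def)
    also have "(\<forall>y<?n. s dvd ?n - y \<longrightarrow> y \<in> insert ?n (beta_set xs)) \<longleftrightarrow>
        (\<forall>y<?n. s dvd ?n - y \<longrightarrow> y \<in> beta_set xs)" by auto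
    also have "(\<forall>b\<in>beta_set xs. \<forall>y<b. s dvd b - y \<longrightarrow> y \<in> insert ?n (beta_set xs)) \<longleftrightarrow>
        core_set s (beta_set xs)"
      unfolding core_set_def using beta_set_less[OF le]
      by (intro ball_cong refl all_cong) (auto dest: less_asym)
    finally show ?thesis using Cons.IH[OF p] by simp
  qed
  finally show ?case .
qed

section \<open>Encoding strict cores by sparse sequences\<close>

text \<open>
  Sequences supported on positions 1 to \<open>k\<close>, with values at most \<open>d\<close> and no two adjacent non-zero
  values. Sequences are total functions on the naturals that vanish outside \<open>{1..k}\<close>.
\<close>

definition sparse_seqs :: "nat \<Rightarrow> nat \<Rightarrow> (nat \<Rightarrow> nat) set" where
  "sparse_seqs d k = {a. (\<forall>i. a i \<le> d) \<and> (\<forall>i. a i = 0 \<or> a (Suc i) = 0)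
     \<and> (\<forall>i. i \<notin> {1..k} \<longrightarrow> a i = 0)}"

text \<open>
  The set with \<open>a i\<close> elements in the residue class \<open>i\<close> modulo \<open>n\<close>, namely
  \<open>i, i + n, \<dots>, i + (a i - 1) n\<close>; these are the beads on runner \<open>i\<close> of an abacus, pushed down
  as far as possible.
\<close>

definition runner_set :: "nat \<Rightarrow> (nat \<Rightarrow> nat) \<Rightarrow> nat set" where
  "runner_set n a = {b. b div n < a (b mod n)}"

text \<open>
  The beta-sets of strict partitions that are simultaneously \<open>s\<close>-cores and \<open>t\<close>-cores.
\<close>

definition strict_core_sets :: "nat \<Rightarrow> nat \<Rightarrow> nat set set" where
  "strict_core_sets s t = {B. finite B \<and> 0 \<notin> B \<and> (\<forall>b\<in>B. Suc b \<notin> B) \<and> core_set s B \<and> core_set t B}"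

lemma bij_betw_beta_set: "bij_betw beta_set (strict_cores s t) (strict_core_sets s t)"
  unfolding bij_betw_def
proof
  show "inj_on beta_set (strict_cores s t)"
    by (auto simp: inj_on_def strict_cores_def intro: beta_set_inj strict_partition_imp_partition)
  show "beta_set ` strict_cores s t = strict_core_sets s t"
  proof (intro equalityI subsetI)
    fix B assume "B \<in> beta_set ` strict_cores s t"
    then obtain xs where xs: "strict_partition xs" "core s xs" "core t xs" "B = beta_set xs"
      by (auto simp: strict_cores_def)
    then have p: "partition xs" by (simp add: strict_partition_imp_partition)
    have "0 \<notin> B" using beta_set_pos[OF p, of 0] xs(4) by auto
    moreover have "\<forall>b\<in>B. Suc b \<notin> B" using beta_set_no_consecutive[OF xs(1)] xs(4) by blast
    ultimately show "B \<in> strict_core_sets s t"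
      using xs core_iff_core_set[OF p] by (simp add: strict_core_sets_def)
  next
    fix B assume B: "B \<in> strict_core_sets s t"
    then obtain xs where xs: "strict_partition xs" "beta_set xs = B"
      using beta_set_surj[of B] by (auto simp: strict_core_sets_def)
    then have "xs \<in> strict_cores s t"
      using B strict_partition_imp_partition[OF xs(1)]
      by (simp add: strict_cores_def strict_core_sets_def core_iff_core_set)
    then show "B \<in> beta_set ` strict_cores s t" using xs by blast
  qed
qed

lemma mem_runner_set_iff: "i < n \<Longrightarrow> q * n + i \<in> runner_set n a \<longleftrightarrow> q < a i"
  by (simp add: runner_set_def)

lemma runner_set_bij:
  assumes "\<And>i. n \<le> i \<Longrightarrow> a i = 0" "0 < n"
  shows "bij_betw (\<lambda>(i, q). q * n + i) (SIGMA i:{..<n}. {..<a i}) (runner_set n a)"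
proof (rule bij_betwI[where g = "\<lambda>b. (b mod n, b div n)"])
qed (use assms in \<open>auto simp: runner_set_def\<close>)

lemma finite_down_closed_eq_lessThan:
  fixes S :: "nat set"
  assumes "finite S" "\<And>p q. q \<in> S \<Longrightarrow> p < q \<Longrightarrow> p \<in> S"
  shows "S = {..<card S}"
proof -
  have "\<exists>m. S = {..<m}"
  proof (cases "S = {}")
    case False
    have "p \<in> S" if "p \<le> Max S" for p
      using that assms(2)[of "Max S" p] Max_in[OF assms(1) False] by (cases "p = Max S") auto
    then have "S = {..Max S}" using Max_ge[OF assms(1)] by auto
    then have "S = {..<Suc (Max S)}" by (simp only: lessThan_Suc_atMost)
    then show ?thesis by blast
  qed auto
  then show ?thesis by auto
qed

text \<open>
  In a strict \<open>(n, dn + 1)\<close>-core, more than \<open>d\<close> beads on runner \<open>i\<close> would put \<open>dn + i\<close>, hence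
  \<open>i - 1\<close>, into the beta-set next to \<open>i\<close>. Conversely, if all runners carry at most \<open>d\<close> beads,
  every element is less than \<open>dn\<close> and the \<open>(dn + 1)\<close>-core condition is vacuous.
\<close>

lemma bij_betw_runner_set:
  assumes "0 < n"
  shows "bij_betw (runner_set n) (sparse_seqs d (n - 1)) (strict_core_sets n (d * n + 1))"
  unfolding bij_betw_def
proof
  have zero: "a i = 0" if "a \<in> sparse_seqs d (n - 1)" "n \<le> i" for a i
    using that assms by (auto simp: sparse_seqs_def)
  have eq: "a i = a' i" if "a \<in> sparse_seqs d (n - 1)" "a' \<in> sparse_seqs d (n - 1)"
      "runner_set n a = runner_set n a'" for a a' i
  proof (cases "i < n")
    case True
    then have "q < a i \<longleftrightarrow> q < a' i" for q
      using that mem_runner_set_iff by metis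
    then show ?thesis by (meson linorder_neqE_nat less_irrefl)
  next
    case False
    then show ?thesis using zero[OF that(1)] zero[OF that(2)] by simp
  qed
  then show "inj_on (runner_set n) (sparse_seqs d (n - 1))"
    by (auto intro!: inj_onI)
  show "runner_set n ` sparse_seqs d (n - 1) = strict_core_sets n (d * n + 1)"
  proof (intro equalityI subsetI)
    fix B assume "B \<in> runner_set n ` sparse_seqs d (n - 1)"
    then obtain a where a: "a \<in> sparse_seqs d (n - 1)" and B: "B = runner_set n a" by auto
    have ad: "a i \<le> d" "a i = 0 \<or> a (Suc i) = 0" "a 0 = 0" for i
      using a by (auto simp: sparse_seqs_def)
    have bound: "b < d * n" if "b \<in> B" for b
    proof -
      have "b div n < d" using that ad(1)[of "b mod n"] by (auto simp: B runner_set_def)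
      then show ?thesis using assms by (simp add: div_less_iff_less_mult)
    qed
    have "finite B" by (rule finite_subset[of _ "{..<d * n}"]) (use bound in auto)
    moreover have "0 \<notin> B" using ad by (simp add: B runner_set_def)
    moreover have "Suc b \<notin> B" if "b \<in> B" for b
    proof (cases "Suc b mod n = 0")
      case True
      then show ?thesis using ad by (simp add: B runner_set_def)
    next
      case False
      then have "Suc b mod n = Suc (b mod n)" by (simp add: mod_Suc split: if_splits)
      then show ?thesis using that ad(2)[of "b mod n"] by (auto simp: B runner_set_def)
    qed
    moreover have "core_set n B"
    proof (unfold core_set_def, intro ballI allI impI)
      fix b y assume b: "b \<in> B" "y < b" "n dvd b - y"
      have "b mod n = y mod n" using b by (simp add: mod_eq_dvd_iff_nat)
      moreover have "y div n \<le> b div n" using b by (intro div_le_mono) simp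
      ultimately show "y \<in> B" using b(1) by (simp add: B runner_set_def)
    qed
    moreover have "core_set (d * n + 1) B"
    proof (unfold core_set_def, intro ballI allI impI)
      fix b y assume b: "b \<in> B" "y < b" "d * n + 1 dvd b - y"
      then have "d * n + 1 \<le> b - y" by (intro dvd_imp_le) auto
      then show "y \<in> B" using bound[OF b(1)] by simp
    qed
    ultimately show "B \<in> strict_core_sets n (d * n + 1)" by (simp add: strict_core_sets_def)
  next
    fix B assume "B \<in> strict_core_sets n (d * n + 1)"
    then have fin: "finite B" and z: "0 \<notin> B" and nc: "\<And>b. b \<in> B \<Longrightarrow> Suc b \<notin> B"
      and cn: "core_set n B" and ct: "core_set (d * n + 1) B"
      by (auto simp: strict_core_sets_def)
    define a where "a = (\<lambda>i. if i < n then card {q. q * n + i \<in> B} else 0)"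
    have down: "{q. q * n + i \<in> B} = {..<a i}" if "i < n" for i
    proof -
      have fq: "finite {q. q * n + i \<in> B}"
        by (rule finite_imageD[of "\<lambda>q. q * n + i"])
           (use assms in \<open>auto intro!: inj_onI intro: finite_subset[OF _ fin]\<close>)
      have "p * n + i \<in> B" if q: "q * n + i \<in> B" "p < q" for p q
      proof -
        have "p * n + i < q * n + i" using q assms by simp
        moreover have "n dvd q * n + i - (p * n + i)" by (simp add: dvd_diff_nat)
        ultimately show ?thesis using cn q(1) unfolding core_set_def by blast
      qed
      then show ?thesis
        using finite_down_closed_eq_lessThan[OF fq] that by (simp add: a_def)
    qed
    have mem: "q * n + i \<in> B \<longleftrightarrow> q < a i" if "i < n" for q i
      using down[OF that] by auto
    have a0: "a 0 = 0" using mem[of 0 0] z assms by auto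
    have big: "a i = 0" if "n \<le> i" for i using that by (simp add: a_def)
    have "a i = 0 \<or> a (Suc i) = 0" for i
      using mem[of i 0] mem[of "Suc i" 0] nc[of i] big[of "Suc i"] by (cases "Suc i < n") auto
    moreover have "a i \<le> d" for i
    proof (rule ccontr)
      assume "\<not> a i \<le> d"
      then have i: "d < a i" "i < n" "i \<noteq> 0" using a0 big by (auto intro: ccontr)
      then have b: "d * n + i \<in> B" "i \<in> B" using mem[of i d] mem[of i 0] by auto
      have "d * n + i - (i - 1) = d * n + 1" using i by simp
      then have "d * n + 1 dvd d * n + i - (i - 1)" by simp
      moreover have "i - 1 < d * n + i" using i by simp
      ultimately have "i - 1 \<in> B" using ct b(1) unfolding core_set_def by blast
      then show False using nc[of "i - 1"] b(2) i by simp
    qed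
    moreover have "a i = 0" if "i \<notin> {1..n - 1}" for i
    proof -
      have "i = 0 \<or> n \<le> i" using that by auto
      then show ?thesis using a0 big by auto
    qed
    ultimately have "a \<in> sparse_seqs d (n - 1)"
      unfolding sparse_seqs_def by blast
    moreover have "runner_set n a = B"
      using mem[of "b mod n" "b div n" for b] assms by (auto simp: runner_set_def)
    ultimately show "B \<in> runner_set n ` sparse_seqs d (n - 1)" by blast
  qed
qed


lemma card_runner_set:
  assumes "a \<in> sparse_seqs d (n - 1)" "0 < n"
  shows "card (runner_set n a) = (\<Sum>i=1..n - 1. a i)"
proof -
  have "a i = 0" if "n \<le> i" for i using assms that by (auto simp: sparse_seqs_def)
  then have "card (runner_set n a) = card (SIGMA i:{..<n}. {..<a i})"
    using bij_betw_same_card[OF runner_set_bij] assms(2) by metis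
  also have "\<dots> = (\<Sum>i<n. a i)" by simp
  also have "\<dots> = (\<Sum>i=1..n - 1. a i)"
    using assms by (intro sum.mono_neutral_right) (auto simp: sparse_seqs_def)
  finally show ?thesis .
qed

lemma sum_lessThan_real: "real (\<Sum>{..<m}) = real m * (real m - 1) / 2"
  by (induction m) (auto simp: field_simps)

lemma sum_runner_set:
  assumes "a \<in> sparse_seqs d (n - 1)" "0 < n"
  shows "real (\<Sum>(runner_set n a)) =
    (\<Sum>i=1..n - 1. real i * real (a i) + real n * (real (a i) * (real (a i) - 1) / 2))"
proof -
  have "a i = 0" if "n \<le> i" for i using assms that by (auto simp: sparse_seqs_def)
  then have "\<Sum>(runner_set n a) = (\<Sum>(i, q)\<in>(SIGMA i:{..<n}. {..<a i}). q * n + i)"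
    using sum.reindex_bij_betw[OF runner_set_bij, of n a "\<lambda>b. b"] assms(2)
    by (simp add: case_prod_unfold)
  also have "\<dots> = (\<Sum>i<n. \<Sum>q<a i. q * n + i)"
    by (simp add: sum.Sigma)
  also have "\<dots> = (\<Sum>i<n. i * a i + n * \<Sum>{..<a i})"
    by (simp add: sum.distrib sum_distrib_left mult.commute add.commute)
  also have "real \<dots> = (\<Sum>i<n. real i * real (a i) + real n * (real (a i) * (real (a i) - 1) / 2))"
    by (subst of_nat_sum) (simp only: of_nat_add of_nat_mult sum_lessThan_real)
  also have "\<dots> = (\<Sum>i=1..n - 1. real i * real (a i) + real n * (real (a i) * (real (a i) - 1) / 2))"
    using assms by (intro sum.mono_neutral_right) (auto simp: sparse_seqs_def)
  finally show ?thesis .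
qed

text \<open>
  The size of the core encoded by \<open>a\<close>, for \<open>n = k + 1\<close>: the sum of the elements of the beta-set
  minus \<open>0 + 1 + \<dots> + (l - 1)\<close>, where \<open>l\<close> is the number of parts. The values are real so that
  subtraction and division by 2 are harmless.
\<close>

definition core_stat :: "nat \<Rightarrow> (nat \<Rightarrow> nat) \<Rightarrow> real" where
  "core_stat k a = (\<Sum>i=1..k. real i * real (a i) + real (Suc k) * (real (a i) * (real (a i) - 1) / 2))
      - real (\<Sum>i=1..k. a i) * (real (\<Sum>i=1..k. a i) - 1) / 2"

lemma strict_cores_encoding:
  obtains \<phi> where "bij_betw \<phi> (sparse_seqs d k) (strict_cores (Suc k) (d * Suc k + 1))"
    and "\<And>a. a \<in> sparse_seqs d k \<Longrightarrow> real (sum_list (\<phi> a)) = core_stat k a"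
proof
  let ?C = "strict_cores (Suc k) (d * Suc k + 1)"
  define \<phi> where "\<phi> = inv_into ?C beta_set \<circ> runner_set (Suc k)"
  have bij: "bij_betw (runner_set (Suc k)) (sparse_seqs d k) (strict_core_sets (Suc k) (d * Suc k + 1))"
    using bij_betw_runner_set[of "Suc k" d] by simp
  show "bij_betw \<phi> (sparse_seqs d k) ?C"
    unfolding \<phi>_def using bij bij_betw_inv_into[OF bij_betw_beta_set] by (rule bij_betw_trans)
  fix a assume a: "a \<in> sparse_seqs d k"
  then have a': "a \<in> sparse_seqs d (Suc k - 1)" by simp
  have mem: "runner_set (Suc k) a \<in> beta_set ` ?C"
    using bij_betw_apply[OF bij a] bij_betw_beta_set[of "Suc k" "d * Suc k + 1"] by (simp add: bij_betw_def)
  have "\<phi> a \<in> ?C" unfolding \<phi>_def comp_def by (rule inv_into_into[OF mem])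
  then have p: "partition (\<phi> a)" by (simp add: strict_cores_def strict_partition_def)
  have beta: "beta_set (\<phi> a) = runner_set (Suc k) a"
    unfolding \<phi>_def comp_def by (rule f_inv_into_f[OF mem])
  have "real (\<Sum>(runner_set (Suc k) a)) = real (sum_list (\<phi> a))
      + real (card (runner_set (Suc k) a)) * (real (card (runner_set (Suc k) a)) - 1) / 2"
    using sum_beta_set[OF p] card_beta_set[OF p] sum_lessThan_real[of "length (\<phi> a)"]
    unfolding beta by simp
  then show "real (sum_list (\<phi> a)) = core_stat k a"
    unfolding sum_runner_set[OF a' zero_less_Suc] card_runner_set[OF a' zero_less_Suc]
    by (simp add: core_stat_def)
qed

section \<open>Second-order expansion of a cumulant generating function\<close>

text \<open>
  The mean of \<open>f\<close> over the finite set \<open>A\<close>, that is, its expectation under the uniform distribution.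
\<close>

definition avg :: "'a set \<Rightarrow> ('a \<Rightarrow> 'b::real_normed_field) \<Rightarrow> 'b" where
  "avg A f = sum f A / of_nat (card A)"

lemma avg_cong: "(\<And>a. a \<in> A \<Longrightarrow> f a = g a) \<Longrightarrow> avg A f = avg A g"
  by (simp add: avg_def)

text \<open>
  If the moment generating function of a centred variable \<open>X\<close> has a holomorphic logarithm \<open>G\<close> that is
  bounded by \<open>C\<close> on a disc of radius \<open>\<rho>\<close>, then Cauchy's inequalities bound both the variance, which is
  the second derivative of \<open>G\<close> at 0, and the third-order Taylor remainder of \<open>G\<close>.
\<close>

lemma quadratic_log_moment_generating:
  fixes X :: "'a \<Rightarrow> real" and G :: "complex \<Rightarrow> complex" and \<rho> C V :: real
  assumes A: "finite A" "A \<noteq> {}" and centred: "avg A X = 0" and V: "V = avg A (\<lambda>a. (X a)\<^sup>2)"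
    and hol: "G holomorphic_on ball 0 \<rho>" and \<rho>: "0 < \<rho>" and G0: "G 0 = 0"
    and bound: "\<And>z. z \<in> ball 0 \<rho> \<Longrightarrow> cmod (G z) \<le> C"
    and expG: "\<And>z. z \<in> ball 0 \<rho> \<Longrightarrow>
      exp (G z) = avg A (\<lambda>a. exp (z * of_real (X a)))"
  shows "V \<le> 8 * C / \<rho>\<^sup>2"
    and "cmod z < \<rho> / 2 \<Longrightarrow> cmod (G z - of_real V * z\<^sup>2 / 2) \<le> 24 * C * (cmod z / \<rho>) ^ 3"
proof -
  have N: "card A \<noteq> 0" using A by simp
  have open_b: "open (ball 0 \<rho> :: complex set)" by simp
  have z0: "(0::complex) \<in> ball 0 \<rho>" using \<rho> by simp
  define P where "P = (\<lambda>m z. avg A (\<lambda>a. of_real (X a ^ m) * exp (z * of_real (X a))) :: complex)"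
  have dP: "(P m has_field_derivative P (Suc m) z) (at z)" for m z
  proof -
    have "((\<lambda>z. of_real (X a ^ m) * exp (z * of_real (X a))) has_field_derivative
        of_real (X a ^ Suc m) * exp (z * of_real (X a))) (at z)" for a
      by (auto intro!: derivative_eq_intros)
    then show ?thesis unfolding P_def avg_def by (intro DERIV_cdivide DERIV_sum)
  qed
  have dG: "(G has_field_derivative deriv G z) (at z)" if "z \<in> ball 0 \<rho>" for z
    using that hol by (simp add: holomorphic_derivI)
  have deriv_G: "deriv G z = P 1 z * exp (- G z)" if z: "z \<in> ball 0 \<rho>" for z
  proof -
    have "((\<lambda>z. exp (G z)) has_field_derivative exp (G z) * deriv G z) (at z)"
      by (rule DERIV_chain2[OF DERIV_exp dG[OF z]])
    then have "(P 0 has_field_derivative exp (G z) * deriv G z) (at z)"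
      by (rule has_field_derivative_transform_within_open[OF _ open_b z]) (simp add: expG P_def)
    then have "exp (G z) * deriv G z = P 1 z"
      using dP[of 0 z] by (simp add: DERIV_unique)
    then show ?thesis by (simp add: exp_minus field_simps)
  qed
  have P0: "P 2 0 = of_real V" by (simp add: P_def V avg_def)
  have P1: "P 1 0 = 0" using centred N by (simp add: P_def avg_def flip: of_real_sum)
  have deriv0: "deriv G 0 = 0"
    using deriv_G[OF z0] P1 by simp
  have "((\<lambda>z. P 1 z * exp (- G z)) has_field_derivative
      P (Suc 1) 0 * exp (- G 0) + exp (- G 0) * - deriv G 0 * P 1 0) (at 0)"
    by (rule DERIV_mult[OF dP DERIV_chain2[OF DERIV_exp DERIV_minus[OF dG[OF z0]]]])
  then have "((\<lambda>z. P 1 z * exp (- G z)) has_field_derivative of_real V) (at 0)"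
    using P0 P1 G0 by (simp add: numeral_2_eq_2)
  then have "(deriv G has_field_derivative of_real V) (at 0)"
    by (rule has_field_derivative_transform_within_open[OF _ open_b z0]) (simp add: deriv_G)
  then have deriv2: "(deriv ^^ 2) G 0 = of_real V"
    by (simp add: DERIV_imp_deriv numeral_2_eq_2)
  \<comment> \<open>Discs of radius \<open>\<rho> / 2\<close> around points of norm less than \<open>\<rho> / 2\<close> stay inside the disc of radius \<open>\<rho>\<close>.\<close>
  have cauchy: "cmod ((deriv ^^ m) G x) \<le> fact m * C / (\<rho> / 2) ^ m" if x: "x \<in> ball 0 (\<rho> / 2)" for m x
  proof (rule Cauchy_inequality)
    have sub: "cball x (\<rho> / 2) \<subseteq> ball 0 \<rho>"
    proof
      fix y assume "y \<in> cball x (\<rho> / 2)"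
      then have "cmod y \<le> cmod x + \<rho> / 2"
        using norm_triangle_ineq2[of y x] by (simp add: dist_norm norm_minus_commute)
      then show "y \<in> ball 0 \<rho>" using x by simp
    qed
    then show "G holomorphic_on ball x (\<rho> / 2)"
      using hol ball_subset_cball by (meson holomorphic_on_subset order_trans)
    show "continuous_on (cball x (\<rho> / 2)) G"
      using hol sub by (meson holomorphic_on_imp_continuous_on continuous_on_subset)
    show "0 < \<rho> / 2" using \<rho> by simp
    fix y assume "cmod (x - y) = \<rho> / 2"
    then have "y \<in> cball x (\<rho> / 2)" by (simp add: dist_norm)
    then show "cmod (G y) \<le> C" using sub bound by blast
  qed
  have "V \<le> cmod ((deriv ^^ 2) G 0)" unfolding deriv2 by simp
  also have "\<dots> \<le> 8 * C / \<rho>\<^sup>2"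
    using cauchy[of 0 2] \<rho> by (simp add: power_divide)
  finally show "V \<le> 8 * C / \<rho>\<^sup>2" .
  assume z: "cmod z < \<rho> / 2"
  have "cmod ((deriv ^^ 0) G z - (\<Sum>i\<le>2. (deriv ^^ i) G 0 * (z - 0) ^ i / fact i))
      \<le> (fact 3 * C / (\<rho> / 2) ^ 3) * cmod (z - 0) ^ Suc 2 / fact 2"
  proof (rule complex_Taylor)
    show "convex (ball 0 (\<rho> / 2) :: complex set)" by simp
    show "0 \<in> ball (0::complex) (\<rho> / 2)" "z \<in> ball 0 (\<rho> / 2)" using \<rho> z by auto
    show "cmod ((deriv ^^ Suc 2) G x) \<le> fact 3 * C / (\<rho> / 2) ^ 3" if "x \<in> ball 0 (\<rho> / 2)" for x
      using cauchy[OF that, of 3] by (simp add: numeral_3_eq_3 numeral_2_eq_2)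
    show "((deriv ^^ i) G has_field_derivative (deriv ^^ Suc i) G x) (at x within ball 0 (\<rho> / 2))"
      if "x \<in> ball 0 (\<rho> / 2)" for i x
    proof -
      have "x \<in> ball 0 \<rho>" using that \<rho> by simp
      from has_field_derivative_higher_deriv[OF hol open_b this]
      show ?thesis by (rule has_field_derivative_at_within)
    qed
  qed
  also have "(\<Sum>i\<le>2. (deriv ^^ i) G 0 * (z - 0) ^ i / fact i) = of_real V * z\<^sup>2 / 2"
    using deriv2 by (simp add: numeral_2_eq_2 G0 deriv0)
  also have "(fact 3 * C / (\<rho> / 2) ^ 3) * cmod (z - 0) ^ Suc 2 / fact 2 = 24 * C * (cmod z / \<rho>) ^ 3"
    by (simp add: power_divide fact_numeral)
  finally show "cmod (G z - of_real V * z\<^sup>2 / 2) \<le> 24 * C * (cmod z / \<rho>) ^ 3"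
    by simp
qed

section \<open>Zero-free region of hard-core partition functions\<close>

text \<open>
  The partition function of the hard-core model on a path with \<open>k\<close> vertices and activity \<open>w i\<close> at
  vertex \<open>i\<close>: the sum, over all sets of pairwise non-adjacent vertices, of the products of their
  activities. It is defined by the recursion on whether the last vertex is occupied.
\<close>

fun hard_core_sum :: "(nat \<Rightarrow> 'a::comm_semiring_1) \<Rightarrow> nat \<Rightarrow> 'a" where
  "hard_core_sum w 0 = 1"
| "hard_core_sum w (Suc 0) = 1 + w 1"
| "hard_core_sum w (Suc (Suc k)) = hard_core_sum w (Suc k) + w (Suc (Suc k)) * hard_core_sum w k"

text \<open>
  Activities close to \<open>d\<close> keep the partition functions away from zero: the region of all \<open>r\<close> with
  \<open>Re r \<ge> 1\<close> and \<open>\<bar>r\<bar> \<le> d + 2\<close> is invariant under the maps \<open>r \<mapsto> 1 + w / r\<close> that produce each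
  quotient of consecutive partition functions from the previous one.
\<close>

lemma hard_core_ratio:
  fixes w :: "nat \<Rightarrow> complex" and d :: nat
  assumes w: "\<And>i. 1 \<le> i \<Longrightarrow> i \<le> n \<Longrightarrow> cmod (w i - of_nat d) \<le> d / (real d + 2)\<^sup>2"
    and k: "k < n"
  shows "hard_core_sum w k \<noteq> 0 \<and> 1 \<le> Re (hard_core_sum w (Suc k) / hard_core_sum w k)
    \<and> cmod (hard_core_sum w (Suc k) / hard_core_sum w k) \<le> real d + 2"
  using k
proof (induction k)
  let ?R = "real d + 2"
  have small: "real d / ?R\<^sup>2 \<le> 1"
    by (simp add: power2_eq_square divide_le_eq) (auto simp: algebra_simps)
  {
    case 0
    have w1: "cmod (w 1 - of_nat d) \<le> d / ?R\<^sup>2" using w[of 1] 0 by simp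
    have re: "\<bar>Re (w 1 - of_nat d)\<bar> \<le> d / ?R\<^sup>2" using abs_Re_le_cmod w1 by (rule order_trans)
    have "d / ?R\<^sup>2 \<le> d"
      by (simp add: divide_le_eq power2_eq_square) (auto simp: algebra_simps)
    then have "0 \<le> Re (w 1)" using re by simp
    moreover have "cmod (1 + w 1) \<le> 1 + (d + cmod (w 1 - of_nat d))"
      using norm_triangle_ineq[of 1 "w 1"] norm_triangle_ineq[of "of_nat d" "w 1 - of_nat d"] by simp
    then have "cmod (1 + w 1) \<le> ?R" using w1 small by linarith
    ultimately have "0 \<le> Re (w 1)" "cmod (1 + w 1) \<le> ?R" by auto
    then show ?case by simp
  next
    case (Suc k)
    define r where "r = hard_core_sum w (Suc k) / hard_core_sum w k"
    have r: "hard_core_sum w k \<noteq> 0" "1 \<le> Re r" "cmod r \<le> ?R"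
      using Suc by (auto simp: r_def)
    have rpos: "1 \<le> cmod r" using r(2) complex_Re_le_cmod[of r] by linarith
    have nz: "hard_core_sum w (Suc k) \<noteq> 0" using rpos by (auto simp: r_def)
    define v where "v = w (Suc (Suc k))"
    have v: "cmod (v - of_nat d) \<le> d / ?R\<^sup>2" using w[of "Suc (Suc k)"] Suc.prems by (simp add: v_def)
    have eq: "hard_core_sum w (Suc (Suc k)) / hard_core_sum w (Suc k) = 1 + v / r"
      using nz r(1) by (simp add: r_def v_def field_simps)
    have dec: "v / r = of_nat d / r + (v - of_nat d) / r"
      by (simp add: diff_divide_distrib)
    have err: "cmod ((v - of_nat d) / r) \<le> d / ?R\<^sup>2"
    proof -
      have "cmod ((v - of_nat d) / r) \<le> cmod (v - of_nat d) / 1"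
        unfolding norm_divide using rpos by (intro divide_left_mono) auto
      then show ?thesis using v by simp
    qed
    have "1 / ?R\<^sup>2 \<le> Re r / (cmod r)\<^sup>2"
      using r rpos by (intro frac_le power_mono zero_less_power) auto
    then have "d * (1 / ?R\<^sup>2) \<le> d * (Re r / (cmod r)\<^sup>2)"
      by (rule mult_left_mono) simp
    also have "d * (Re r / (cmod r)\<^sup>2) = Re (of_nat d / r)"
      by (simp add: Re_divide cmod_power2)
    finally have "d / ?R\<^sup>2 \<le> Re (of_nat d / r)" by simp
    then have "0 \<le> Re (v / r)"
      unfolding dec using err abs_Re_le_cmod[of "(v - of_nat d) / r"] by simp
    moreover have "cmod (1 + v / r) \<le> ?R"
    proof -
      have "cmod (of_nat d / r) \<le> d / 1"
        unfolding norm_divide using rpos by (simp add: divide_le_eq mult_le_cancel_left1)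
      then have "cmod (v / r) \<le> d + d / ?R\<^sup>2"
        unfolding dec using err norm_triangle_ineq[of "of_nat d / r" "(v - of_nat d) / r"] by linarith
      moreover have "cmod (1 + v / r) \<le> 1 + cmod (v / r)"
        using norm_triangle_ineq[of 1 "v / r"] by simp
      ultimately show ?thesis using small by linarith
    qed
    ultimately show ?case unfolding eq using nz by simp
  }
qed

section \<open>Additive statistics of sparse sequences\<close>

lemma finite_sparse_seqs [simp]: "finite (sparse_seqs d k)"
proof (rule finite_subset)
  show "sparse_seqs d k \<subseteq> {a. \<forall>i. (i \<in> {1..k} \<longrightarrow> a i \<in> {..d}) \<and> (i \<notin> {1..k} \<longrightarrow> a i = 0)}"
    by (auto simp: sparse_seqs_def)
  show "finite {a. \<forall>i. (i \<in> {1..k} \<longrightarrow> a i \<in> {..d}) \<and> (i \<notin> {1..k} \<longrightarrow> a i = 0)}"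
    by (rule finite_set_of_finite_funs) auto
qed

lemma zero_in_sparse_seqs [simp]: "(\<lambda>_. 0) \<in> sparse_seqs d k"
  by (simp add: sparse_seqs_def)

lemma sparse_seqs_nonempty [simp]: "sparse_seqs d k \<noteq> {}"
  using zero_in_sparse_seqs by blast

lemma card_sparse_seqs_pos [simp]: "0 < card (sparse_seqs d k)"
  by (simp add: card_gt_0_iff)

lemma sparse_seqs_0: "sparse_seqs d 0 = {\<lambda>_. 0}"
  by (auto simp: sparse_seqs_def)

lemma sparse_seqs_1: "sparse_seqs d (Suc 0) = (\<lambda>u. (\<lambda>_. 0)(1 := u)) ` {0..d}"
proof (intro equalityI subsetI)
  fix a assume "a \<in> sparse_seqs d (Suc 0)"
  then have "a 1 \<le> d" "a = (\<lambda>_. 0)(1 := a 1)" by (auto simp: sparse_seqs_def fun_eq_iff)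
  then show "a \<in> (\<lambda>u. (\<lambda>_. 0)(1 := u)) ` {0..d}" by auto
qed (auto simp: sparse_seqs_def)

lemma sparse_seqs_Suc_Suc:
  "sparse_seqs d (Suc (Suc k)) =
    sparse_seqs d (Suc k) \<union> (\<lambda>(u, a). a(Suc (Suc k) := u)) ` ({1..d} \<times> sparse_seqs d k)"
proof (intro equalityI subsetI)
  fix a assume a: "a \<in> sparse_seqs d (Suc (Suc k))"
  show "a \<in> sparse_seqs d (Suc k) \<union> (\<lambda>(u, a). a(Suc (Suc k) := u)) ` ({1..d} \<times> sparse_seqs d k)"
  proof (cases "a (Suc (Suc k)) = 0")
    case True
    then have "a i = 0" if "i \<notin> {1..Suc k}" for i
      using that a by (cases "i = Suc (Suc k)") (auto simp: sparse_seqs_def)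
    then have "a \<in> sparse_seqs d (Suc k)" using a by (auto simp: sparse_seqs_def)
    then show ?thesis by blast
  next
    case False
    define b where "b = a(Suc (Suc k) := 0)"
    have z: "a (Suc k) = 0" using a False by (auto simp: sparse_seqs_def)
    have "b i = 0" if "i \<notin> {1..k}" for i
      using that a z by (cases "i = Suc (Suc k)"; cases "i = Suc k") (auto simp: sparse_seqs_def b_def)
    then have "b \<in> sparse_seqs d k" using a by (auto simp: sparse_seqs_def b_def)
    moreover have "a = b(Suc (Suc k) := a (Suc (Suc k)))" by (simp add: b_def)
    moreover have "a (Suc (Suc k)) \<in> {1..d}" using a False by (auto simp: sparse_seqs_def)
    ultimately show ?thesis by (intro UnI2) (auto intro!: image_eqI[of _ _ "(a (Suc (Suc k)), b)"])
  qed
next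
  fix a assume "a \<in> sparse_seqs d (Suc k) \<union> (\<lambda>(u, a). a(Suc (Suc k) := u)) ` ({1..d} \<times> sparse_seqs d k)"
  then show "a \<in> sparse_seqs d (Suc (Suc k))" by (fastforce simp: sparse_seqs_def)
qed

lemma sum_sparse_seqs_1: "(\<Sum>a\<in>sparse_seqs d (Suc 0). f a) = (\<Sum>u=0..d. f ((\<lambda>_. 0)(1 := u)))"
proof -
  have "inj_on (\<lambda>u. (\<lambda>_. 0::nat)(1::nat := u)) {0..d}"
    by (auto simp: inj_on_def dest: fun_upd_eqD)
  then show ?thesis unfolding sparse_seqs_1 by (subst sum.reindex) (auto simp: comp_def)
qed

lemma sum_sparse_seqs_Suc_Suc:
  "(\<Sum>a\<in>sparse_seqs d (Suc (Suc k)). f a) =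
    (\<Sum>a\<in>sparse_seqs d (Suc k). f a) + (\<Sum>u=1..d. \<Sum>a\<in>sparse_seqs d k. f (a(Suc (Suc k) := u)))"
proof -
  let ?g = "\<lambda>(u, a :: nat \<Rightarrow> nat). a(Suc (Suc k) := u)"
  have zero: "a (Suc (Suc k)) = 0" if "a \<in> sparse_seqs d k" for a
    using that by (simp add: sparse_seqs_def)
  have inj: "inj_on ?g ({1..d} \<times> sparse_seqs d k)"
  proof (rule inj_onI, clarify)
    fix u a v b assume *: "a \<in> sparse_seqs d k" "b \<in> sparse_seqs d k"
      "a(Suc (Suc k) := u) = b(Suc (Suc k) := v)"
    have "a i = b i" for i
      using fun_cong[OF *(3), of i] zero[OF *(1)] zero[OF *(2)] by (auto split: if_splits)
    then show "u = v \<and> a = b" using fun_upd_eqD[OF *(3)] by auto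
  qed
  have disj: "sparse_seqs d (Suc k) \<inter> ?g ` ({1..d} \<times> sparse_seqs d k) = {}"
  proof -
    have "a \<notin> ?g ` ({1..d} \<times> sparse_seqs d k)" if "a \<in> sparse_seqs d (Suc k)" for a
    proof -
      have "a (Suc (Suc k)) = 0" using that by (simp add: sparse_seqs_def)
      then show ?thesis by auto
    qed
    then show ?thesis by blast
  qed
  show ?thesis
    unfolding sparse_seqs_Suc_Suc
    by (subst sum.union_disjoint[OF _ _ disj])
       (simp_all only: sum.reindex[OF inj], simp_all add: case_prod_unfold comp_def sum.cartesian_product)
qed

text \<open>
  The additive statistic in which position \<open>i\<close> with value \<open>u\<close> contributes \<open>g i u\<close>. All
  statistics considered below satisfy \<open>g i 0 = 0\<close>, so empty positions do not contribute.
\<close>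

definition lin_stat :: "(nat \<Rightarrow> nat \<Rightarrow> real) \<Rightarrow> nat \<Rightarrow> (nat \<Rightarrow> nat) \<Rightarrow> real" where
  "lin_stat g k a = (\<Sum>i=1..k. g i (a i))"

lemma lin_stat_Suc:
  assumes "a \<in> sparse_seqs d k" "g (Suc k) 0 = 0"
  shows "lin_stat g (Suc k) a = lin_stat g k a"
  using assms by (simp add: lin_stat_def sparse_seqs_def)

lemma lin_stat_update:
  assumes "a \<in> sparse_seqs d k" "g (Suc k) 0 = 0"
  shows "lin_stat g (Suc (Suc k)) (a(Suc (Suc k) := u)) = lin_stat g k a + g (Suc (Suc k)) u"
proof -
  have "a (Suc k) = 0" using assms(1) by (simp add: sparse_seqs_def)
  moreover have "(\<Sum>i=1..k. g i ((a(Suc (Suc k) := u)) i)) = (\<Sum>i=1..k. g i (a i))"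
    by (rule sum.cong) auto
  ultimately show ?thesis using assms(2) by (simp add: lin_stat_def)
qed

lemma sum_exp_lin_stat:
  fixes z :: complex
  assumes g0: "\<And>i. g i 0 = 0"
  shows "(\<Sum>a\<in>sparse_seqs d k. exp (z * of_real (lin_stat g k a)))
    = hard_core_sum (\<lambda>i. \<Sum>u=1..d. exp (z * of_real (g i u))) k"
proof (induction k rule: induct_nat_012)
  case 0
  show ?case by (simp add: sparse_seqs_0 lin_stat_def)
next
  case 1
  show ?case
    by (simp add: sum_sparse_seqs_1 lin_stat_def g0 sum.atLeast_Suc_atMost)
next
  case (ge2 k)
  have "(\<Sum>u=1..d. \<Sum>a\<in>sparse_seqs d k. exp (z * of_real (lin_stat g (Suc (Suc k)) (a(Suc (Suc k) := u)))))
      = (\<Sum>u=1..d. \<Sum>a\<in>sparse_seqs d k. exp (z * of_real (g (Suc (Suc k)) u)) * exp (z * of_real (lin_stat g k a)))"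
    by (intro sum.cong refl) (simp add: lin_stat_update g0 distrib_left exp_add)
  also have "\<dots> = (\<Sum>u=1..d. exp (z * of_real (g (Suc (Suc k)) u))) * hard_core_sum (\<lambda>i. \<Sum>u=1..d. exp (z * of_real (g i u))) k"
    unfolding ge2(1)[symmetric] sum_product ..
  finally show ?case
    using ge2(2) by (simp add: sum_sparse_seqs_Suc_Suc lin_stat_Suc g0)
qed

lemma abs_lin_stat_le:
  assumes g: "\<And>i. g i 0 = 0" "\<And>i u. 1 \<le> i \<Longrightarrow> i \<le> n \<Longrightarrow> 1 \<le> u \<Longrightarrow> u \<le> d \<Longrightarrow> \<bar>g i u\<bar> \<le> M"
    and "0 \<le> M" "a \<in> sparse_seqs d n"
  shows "\<bar>lin_stat g n a\<bar> \<le> n * M"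
proof -
  have "\<bar>lin_stat g n a\<bar> \<le> (\<Sum>i=1..n. \<bar>g i (a i)\<bar>)" unfolding lin_stat_def by (rule sum_abs)
  also have "\<dots> \<le> (\<Sum>i=1..n. M)"
  proof (rule sum_mono)
    fix i assume "i \<in> {1..n}"
    then show "\<bar>g i (a i)\<bar> \<le> M"
      using assms by (cases "a i = 0") (auto simp: sparse_seqs_def Suc_le_eq)
  qed
  finally show ?thesis by simp
qed

text \<open>
  Constants for the cumulant generating function of a centred additive statistic with contributions
  bounded by \<open>M\<close>: on the disc of radius \<open>cgf_radius d M\<close>, it is bounded by \<open>cgf_const d\<close> times
  the number of positions.
\<close>

definition cgf_const :: "nat \<Rightarrow> real" where
  "cgf_const d = 2 * (ln (real d + 2) + pi) + 1"

definition cgf_radius :: "nat \<Rightarrow> real \<Rightarrow> real" where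
  "cgf_radius d M = 1 / (2 * (real d + 2)\<^sup>2 * M)"

text \<open>
  The quotients of consecutive partition functions stay in a right half-plane, so the sum of their
  principal logarithms is a holomorphic logarithm of the partition function, and it grows at most
  linearly with the number of positions.
\<close>

lemma lin_stat_moment_generating:
  fixes g :: "nat \<Rightarrow> nat \<Rightarrow> real" and X :: "(nat \<Rightarrow> nat) \<Rightarrow> real" and M V :: real
  assumes g0: "\<And>i. g i 0 = 0"
    and gM: "\<And>i u. 1 \<le> i \<Longrightarrow> i \<le> n \<Longrightarrow> 1 \<le> u \<Longrightarrow> u \<le> d \<Longrightarrow> \<bar>g i u\<bar> \<le> M" and M: "0 < M"
    and X: "\<And>a. X a = lin_stat g n a - avg (sparse_seqs d n) (lin_stat g n)"
    and V: "V = avg (sparse_seqs d n) (\<lambda>a. (X a)\<^sup>2)"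
  shows "V \<le> 8 * (cgf_const d * n) / (cgf_radius d M)\<^sup>2"
    and "cmod z < cgf_radius d M / 2 \<Longrightarrow>
      \<exists>e. cmod e \<le> 24 * (cgf_const d * n) * (cmod z / cgf_radius d M) ^ 3 \<and>
        avg (sparse_seqs d n) (\<lambda>a. exp (z * of_real (X a))) = exp (of_real V * z\<^sup>2 / 2 + e)"
proof -
  define A where "A = sparse_seqs d n"
  define \<rho> where "\<rho> = cgf_radius d M"
  define C where "C = cgf_const d * n"
  define m where "m = avg A (lin_stat g n)"
  have A: "finite A" "A \<noteq> {}" "0 < card A" by (auto simp: A_def)
  have X': "X a = lin_stat g n a - m" for a by (simp add: X m_def A_def)
  have \<rho>: "0 < \<rho>" using M by (simp add: \<rho>_def cgf_radius_def)
  define w where "w = (\<lambda>z i. \<Sum>u=1..d. exp (z * of_real (g i u)) :: complex)"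
  define Z where "Z = (\<lambda>k z. hard_core_sum (w z) k)"
  have wd: "cmod (w z i - of_nat d) \<le> d / (real d + 2)\<^sup>2"
    if "z \<in> ball 0 \<rho>" "1 \<le> i" "i \<le> n" for z i
  proof -
    have "cmod (exp (z * of_real (g i u)) - 1) \<le> 1 / (real d + 2)\<^sup>2" if u: "u \<in> {1..d}" for u
    proof -
      have "cmod (z * of_real (g i u)) = cmod z * \<bar>g i u\<bar>" by (simp add: norm_mult)
      also have "\<dots> \<le> \<rho> * M"
        using that \<open>z \<in> ball 0 \<rho>\<close> \<open>1 \<le> i\<close> \<open>i \<le> n\<close> gM[of i u] \<rho> by (intro mult_mono) auto
      also have "\<rho> * M = 1 / (real d + 2)\<^sup>2 / 2" using M by (simp add: \<rho>_def cgf_radius_def field_simps)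
      finally have le: "cmod (z * of_real (g i u)) \<le> 1 / (real d + 2)\<^sup>2 / 2" .
      have "1 / (real d + 2)\<^sup>2 / 2 \<le> 1 / 2"
        by (simp add: divide_le_eq power2_eq_square) (simp add: algebra_simps)
      then have "cmod (exp (z * of_real (g i u)) - 1) \<le> 3 / 2 * cmod (z * of_real (g i u))"
        using le by (intro norm_exp_bounds) linarith
      also have "\<dots> \<le> 3 / 2 * (1 / (real d + 2)\<^sup>2 / 2)" using le by (intro mult_left_mono) auto
      also have "\<dots> \<le> 1 / (real d + 2)\<^sup>2"
      proof -
        have *: "3 / 2 * (t / 2) \<le> t" if "0 \<le> t" for t :: real using that by simp
        show ?thesis by (rule *) simp
      qed
      finally show ?thesis .
    qed
    then have "cmod (\<Sum>u=1..d. exp (z * of_real (g i u)) - 1) \<le> (\<Sum>u=1..d. 1 / (real d + 2)\<^sup>2)"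
      by (rule sum_norm_le)
    then show ?thesis by (simp add: w_def sum_subtractf)
  qed
  have ratio: "Z k z \<noteq> 0 \<and> 1 \<le> Re (Z (Suc k) z / Z k z) \<and> cmod (Z (Suc k) z / Z k z) \<le> real d + 2"
    if "z \<in> ball 0 \<rho>" "k < n" for z k
    unfolding Z_def by (rule hard_core_ratio[OF wd[OF that(1)] that(2)])
  define L where "L = (\<lambda>z. \<Sum>k<n. Ln (Z (Suc k) z / Z k z))"
  have exp_L: "exp (L z) = Z n z" if "z \<in> ball 0 \<rho>" for z
  proof -
    have "Z (Suc k) z / Z k z \<noteq> 0" if "k < n" for k
    proof -
      have "q \<noteq> 0" if "1 \<le> Re q" for q using that by auto
      then show ?thesis using ratio[OF \<open>z \<in> ball 0 \<rho>\<close> that] by blast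
    qed
    then have "exp (L z) = (\<Prod>k<n. Z (Suc k) z / Z k z)"
      unfolding L_def by (simp add: exp_sum)
    also have "\<dots> = Z n z / Z 0 z"
    proof -
      have "n' \<le> n \<Longrightarrow> (\<Prod>k<n'. Z (Suc k) z / Z k z) = Z n' z / Z 0 z" for n'
        using ratio[OF \<open>z \<in> ball 0 \<rho>\<close>] by (induction n') (auto simp: Z_def)
      then show ?thesis by simp
    qed
    finally show ?thesis by (simp add: Z_def)
  qed
  have norm_L: "cmod (L z) \<le> n * (ln (real d + 2) + pi)" if "z \<in> ball 0 \<rho>" for z
  proof -
    have "cmod (Ln (Z (Suc k) z / Z k z)) \<le> ln (real d + 2) + pi" if "k < n" for k
    proof -
      define r where "r = Z (Suc k) z / Z k z"
      have r: "1 \<le> Re r" "cmod r \<le> real d + 2"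
        using ratio[OF \<open>z \<in> ball 0 \<rho>\<close> that] by (auto simp: r_def)
      have r1: "1 \<le> cmod r" using r(1) complex_Re_le_cmod[of r] by linarith
      then have "r \<noteq> 0" by auto
      have "cmod (Ln r) \<le> \<bar>Re (Ln r)\<bar> + \<bar>Im (Ln r)\<bar>" by (rule cmod_le)
      also have "\<bar>Re (Ln r)\<bar> = ln (cmod r)" using r1 \<open>r \<noteq> 0\<close> by simp
      also have "ln (cmod r) \<le> ln (real d + 2)" using r r1 by (subst ln_le_cancel_iff) auto
      also have "\<bar>Im (Ln r)\<bar> \<le> pi"
        using \<open>r \<noteq> 0\<close> mpi_less_Im_Ln[of r] Im_Ln_le_pi[of r] by simp
      finally show ?thesis by (simp add: r_def)
    qed
    then have "cmod (L z) \<le> (\<Sum>k<n. ln (real d + 2) + pi)"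
      unfolding L_def by (intro sum_norm_le) simp
    then show ?thesis by simp
  qed
  have hol_w: "(\<lambda>z. w z i) holomorphic_on S" for i S
    unfolding w_def by (intro holomorphic_intros)
  have hol_Z: "Z k holomorphic_on S" for k S
    unfolding Z_def
  proof (induction k rule: induct_nat_012)
    case 1
    show ?case by (simp only: hard_core_sum.simps) (intro holomorphic_on_add holomorphic_on_const hol_w)
  next
    case (ge2 k)
    show ?case
      by (simp only: hard_core_sum.simps) (intro holomorphic_on_add holomorphic_on_mult hol_w ge2)
  qed simp
  have hol_L: "L holomorphic_on ball 0 \<rho>"
    unfolding L_def
  proof (intro holomorphic_on_sum holomorphic_on_Ln' holomorphic_on_divide hol_Z)
    fix k and z :: complex assume k: "k \<in> {..<n}" and z: "z \<in> ball 0 \<rho>"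
    show "Z k z \<noteq> 0" using ratio[OF z, of k] k by simp
    have "1 \<le> Re (Z (Suc k) z / Z k z)" using ratio[OF z, of k] k by simp
    then show "Z (Suc k) z / Z k z \<notin> \<real>\<^sub>\<le>\<^sub>0" by (auto simp: complex_nonpos_Reals_iff)
  qed
  have Zn: "Z n z = (\<Sum>a\<in>A. exp (z * of_real (lin_stat g n a)))" for z
    unfolding Z_def w_def A_def by (rule sum_exp_lin_stat[of g, OF g0, symmetric])
  have m: "\<bar>m\<bar> \<le> n * M"
  proof -
    have "\<bar>\<Sum>a\<in>A. lin_stat g n a\<bar> \<le> (\<Sum>a\<in>A. n * M)"
      using abs_lin_stat_le[of g n d M] g0 gM M by (intro order_trans[OF sum_abs] sum_mono) (auto simp: A_def)
    then show ?thesis using A(3) by (simp add: m_def avg_def divide_le_eq mult.commute)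
  qed
  \<comment> \<open>Subtracting \<open>L 0\<close> divides by the number of sequences; subtracting \<open>z * m\<close> centres the statistic.\<close>
  define G where "G = (\<lambda>z. L z - L 0 - z * of_real m)"
  have z0: "(0::complex) \<in> ball 0 \<rho>" using \<rho> by simp
  have G0: "G 0 = 0" by (simp add: G_def)
  have hol_G: "G holomorphic_on ball 0 \<rho>"
    unfolding G_def by (intro holomorphic_intros hol_L)
  have norm_G: "cmod (G z) \<le> C" if z: "z \<in> ball 0 \<rho>" for z
  proof -
    have "cmod (z * of_real m) \<le> \<rho> * (n * M)"
      using z m \<rho> by (simp add: norm_mult mult_mono)
    also have "\<dots> \<le> real n"
    proof -
      have "\<rho> * M \<le> 1" using M
        by (simp add: \<rho>_def cgf_radius_def divide_le_eq power2_eq_square) (simp add: algebra_simps)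
      then have "real n * (\<rho> * M) \<le> real n * 1" by (intro mult_left_mono) auto
      then show ?thesis by (simp add: mult_ac)
    qed
    finally have "cmod (z * of_real m) \<le> n" by simp
    moreover have "cmod (G z) \<le> cmod (L z) + cmod (L 0) + cmod (z * of_real m)"
      unfolding G_def using norm_triangle_ineq4[of "L z - L 0" "z * of_real m"]
        norm_triangle_ineq4[of "L z" "L 0"] by linarith
    ultimately show ?thesis
      using norm_L[OF z] norm_L[OF z0] by (simp add: C_def cgf_const_def algebra_simps)
  qed
  have exp_G: "exp (G z) = avg A (\<lambda>a. exp (z * of_real (X a)))"
    if z: "z \<in> ball 0 \<rho>" for z
  proof -
    have "exp (G z) = exp (L z) / exp (L 0) * exp (- (z * of_real m))"
      by (simp add: G_def exp_diff exp_minus divide_inverse)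
    also have "\<dots> = (\<Sum>a\<in>A. exp (z * of_real (lin_stat g n a)) * exp (- (z * of_real m))) / of_nat (card A)"
      unfolding exp_L[OF z] exp_L[OF z0] Zn by (simp add: sum_distrib_right)
    also have "\<dots> = avg A (\<lambda>a. exp (z * of_real (X a)))"
      by (simp add: avg_def X' right_diff_distrib exp_diff exp_minus field_simps)
    finally show ?thesis .
  qed
  have centred: "avg A X = 0"
    using A(3) by (simp add: X' sum_subtractf m_def avg_def)
  note quad = quadratic_log_moment_generating[OF A(1,2) centred V[folded A_def] hol_G \<rho> G0]
  have "V \<le> 8 * C / \<rho>\<^sup>2"
    by (rule quad(1)) (erule norm_G, erule exp_G)
  then show "V \<le> 8 * (cgf_const d * n) / (cgf_radius d M)\<^sup>2"
    by (simp only: C_def \<rho>_def)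
  assume "cmod z < cgf_radius d M / 2"
  then have z: "cmod z < \<rho> / 2" by (simp only: \<rho>_def)
  then have zb: "z \<in> ball 0 \<rho>" using \<rho> by simp
  have "cmod (G z - of_real V * z\<^sup>2 / 2) \<le> 24 * C * (cmod z / \<rho>) ^ 3"
    by (rule quad(2)[OF _ _ z]) (erule norm_G, erule exp_G)
  then show "\<exists>e. cmod e \<le> 24 * (cgf_const d * n) * (cmod z / cgf_radius d M) ^ 3 \<and>
      avg (sparse_seqs d n) (\<lambda>a. exp (z * of_real (X a))) = exp (of_real V * z\<^sup>2 / 2 + e)"
    using exp_G[OF zb] unfolding A_def C_def \<rho>_def
    by (intro exI[of _ "G z - of_real V * z\<^sup>2 / 2"]) simp
qed

section \<open>Lower bound for the variance\<close>

lemma card_sparse_seqs_Suc_Suc: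
  "card (sparse_seqs d (Suc (Suc k))) = card (sparse_seqs d (Suc k)) + d * card (sparse_seqs d k)"
  using sum_sparse_seqs_Suc_Suc[of "\<lambda>_. 1::nat" d k] by simp

lemma card_sparse_seqs_Suc_le:
  "card (sparse_seqs d (Suc k)) \<le> (d + 1) * card (sparse_seqs d k)"
proof (cases k)
  case 0
  have "card (sparse_seqs d (Suc 0)) = d + 1"
    using sum_sparse_seqs_1[of "\<lambda>_. 1::nat" d] by simp
  then show ?thesis using 0 by (simp add: sparse_seqs_0)
next
  case (Suc j)
  have "card (sparse_seqs d j) \<le> card (sparse_seqs d (Suc j))"
    by (rule card_mono[OF finite_sparse_seqs]) (auto simp: sparse_seqs_def)
  then have "d * card (sparse_seqs d j) \<le> d * card (sparse_seqs d (Suc j))" by simp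
  then show ?thesis unfolding Suc card_sparse_seqs_Suc_Suc by (simp add: algebra_simps)
qed

lemma sum_power2_shift:
  fixes f :: "'a \<Rightarrow> real" and c \<mu> :: real
  assumes "finite A" "A \<noteq> {}"
  defines "\<mu> \<equiv> sum f A / card A"
  shows "(\<Sum>a\<in>A. (f a - c)\<^sup>2) = (\<Sum>a\<in>A. (f a - \<mu>)\<^sup>2) + card A * (\<mu> - c)\<^sup>2"
proof -
  have "(\<Sum>a\<in>A. f a - \<mu>) = 0" using assms by (simp add: sum_subtractf)
  then have "(\<Sum>a\<in>A. 2 * (\<mu> - c) * (f a - \<mu>)) = 0"
    by (simp flip: sum_distrib_left)
  moreover have "(f a - c)\<^sup>2 = (f a - \<mu>)\<^sup>2 + 2 * (\<mu> - c) * (f a - \<mu>) + (\<mu> - c)\<^sup>2" for a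
    by (simp add: power2_eq_square algebra_simps)
  ultimately show ?thesis by (simp add: sum.distrib)
qed

text \<open>
  If at every position the squared deviations of \<open>g i 1, \<dots>, g i d\<close> from any common centre add up to
  at least \<open>v\<close>, the variance grows at least linearly with the number of positions. Splitting off an occupied last position turns
  the deviation from \<open>c\<close> into one from \<open>c - g (k + 2) u\<close>; the parallel axis identity
  separates the mean squared deviation of the shorter sequence from the spread over \<open>u\<close>.
\<close>

lemma sum_power2_lin_stat_ge:
  fixes c v :: real
  assumes g0: "\<And>i. g i 0 = 0" and d: "1 \<le> d" and v: "0 \<le> v"
    and gv: "\<And>i c. 1 \<le> i \<Longrightarrow> i \<le> n \<Longrightarrow> v \<le> (\<Sum>u=1..d. (g i u - c)\<^sup>2)"
    and k: "k \<le> n"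
  shows "card (sparse_seqs d k) * (v / (1 + 3 * real d) * (real k - 1))
    \<le> (\<Sum>a\<in>sparse_seqs d k. (lin_stat g k a - c)\<^sup>2)"
  using k
proof (induction k arbitrary: c rule: induct_nat_012)
  case 0
  have "v / (1 + 3 * real d) * (real 0 - 1) \<le> 0" using v by (simp add: divide_nonneg_nonneg)
  then show ?case by (simp add: sparse_seqs_0 order_trans[OF _ zero_le_power2])
next
  case 1
  show ?case by (simp add: sum_nonneg)
next
  case (ge2 k)
  let ?N = "real (card (sparse_seqs d k))" and ?N1 = "real (card (sparse_seqs d (Suc k)))"
  define \<kappa> where "\<kappa> = v / (1 + 3 * real d)"
  define \<mu> where "\<mu> = (\<Sum>a\<in>sparse_seqs d k. lin_stat g k a) / ?N"
  define W where "W = (\<Sum>a\<in>sparse_seqs d k. (lin_stat g k a - \<mu>)\<^sup>2)"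
  have \<kappa>: "0 \<le> \<kappa>" "v = \<kappa> * (1 + 3 * real d)" using v by (auto simp: \<kappa>_def)
  \<comment> \<open>This growth bound on the number of sequences makes the gain \<open>v\<close> at the new position
    large enough for the induction.\<close>
  have N1: "?N1 \<le> (d + 1) * ?N" using card_sparse_seqs_Suc_le[of d k] by (metis of_nat_le_iff of_nat_mult)
  have "(\<Sum>u=1..d. \<Sum>a\<in>sparse_seqs d k. (lin_stat g (Suc (Suc k)) (a(Suc (Suc k) := u)) - c)\<^sup>2)
      = (\<Sum>u=1..d. \<Sum>a\<in>sparse_seqs d k. (lin_stat g k a - (c - g (Suc (Suc k)) u))\<^sup>2)"
    by (intro sum.cong refl) (simp add: lin_stat_update g0 algebra_simps)
  also have "\<dots> = (\<Sum>u=1..d. W + ?N * (g (Suc (Suc k)) u - (c - \<mu>))\<^sup>2)"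
    unfolding W_def \<mu>_def
    by (intro sum.cong refl, subst sum_power2_shift) (simp_all add: algebra_simps)
  also have "\<dots> = d * W + ?N * (\<Sum>u=1..d. (g (Suc (Suc k)) u - (c - \<mu>))\<^sup>2)"
    by (simp add: sum.distrib sum_distrib_left)
  also have "\<dots> \<ge> d * (?N * (\<kappa> * (real k - 1))) + ?N * v"
    using ge2.IH(1)[of \<mu>] gv[of "Suc (Suc k)" "c - \<mu>"] ge2.prems
    by (intro add_mono mult_left_mono) (auto simp: W_def \<kappa>_def)
  finally have new: "d * (?N * (\<kappa> * (real k - 1))) + ?N * v \<le>
    (\<Sum>u=1..d. \<Sum>a\<in>sparse_seqs d k. (lin_stat g (Suc (Suc k)) (a(Suc (Suc k) := u)) - c)\<^sup>2)" .
  have old: "?N1 * (\<kappa> * (real (Suc k) - 1)) \<le>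
      (\<Sum>a\<in>sparse_seqs d (Suc k). (lin_stat g (Suc (Suc k)) a - c)\<^sup>2)"
    using ge2.IH(2)[of c] ge2.prems by (simp add: lin_stat_Suc g0 \<kappa>_def)
  have "?N1 * \<kappa> \<le> (d + 1) * ?N * \<kappa>" using N1 \<kappa>(1) by (rule mult_right_mono)
  moreover have "?N * \<kappa> \<le> d * ?N * \<kappa>" using d \<kappa>(1) by (simp add: mult_right_mono mult_le_cancel_right1)
  ultimately have "(?N1 + d * ?N) * (\<kappa> * (real (Suc (Suc k)) - 1)) \<le>
      ?N1 * (\<kappa> * (real (Suc k) - 1)) + (d * (?N * (\<kappa> * (real k - 1))) + ?N * v)"
    unfolding \<kappa>(2) by (simp add: algebra_simps)
  then have "(?N1 + d * ?N) * (\<kappa> * (real (Suc (Suc k)) - 1)) \<le>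
      (\<Sum>a\<in>sparse_seqs d (Suc (Suc k)). (lin_stat g (Suc (Suc k)) a - c)\<^sup>2)"
    using old new by (simp add: sum_sparse_seqs_Suc_Suc)
  then show ?case by (simp add: card_sparse_seqs_Suc_Suc \<kappa>_def)
qed

section \<open>Perturbation of standardized variables\<close>

lemma cmod_iexp_diff_le: "cmod (iexp x - iexp y) \<le> \<bar>x - y\<bar>"
proof -
  have "iexp x - iexp y = iexp y * (iexp (x - y) - 1)"
    by (simp add: right_diff_distrib flip: exp_add)
  then have "cmod (iexp x - iexp y) = cmod (iexp (x - y) - 1)"
    by (simp add: norm_mult)
  also have "\<dots> \<le> \<bar>x - y\<bar>" using iexp_approx1[of "x - y" 0] by simp
  finally show ?thesis .
qed

text \<open>
  The root mean square, which is the \<open>L\<^sup>2\<close> norm for the uniform distribution on \<open>A\<close>.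
\<close>

definition rms :: "'a set \<Rightarrow> ('a \<Rightarrow> real) \<Rightarrow> real" where
  "rms A f = sqrt (avg A (\<lambda>a. (f a)\<^sup>2))"

lemma rms_cong: "(\<And>a. a \<in> A \<Longrightarrow> f a = g a) \<Longrightarrow> rms A f = rms A g"
  by (simp add: rms_def avg_def)

lemma rms_L2_set: "rms A f = L2_set f A / sqrt (card A)"
  by (simp add: rms_def avg_def L2_set_def real_sqrt_divide)

lemma rms_triangle: "rms A (\<lambda>a. f a + g a) \<le> rms A f + rms A g"
  unfolding rms_L2_set using L2_set_triangle_ineq[of f g A]
  by (simp add: divide_right_mono flip: add_divide_distrib)

lemma rms_cmult: "rms A (\<lambda>a. c * f a) = \<bar>c\<bar> * rms A f"
  by (simp add: rms_def avg_def power_mult_distrib real_sqrt_mult flip: sum_distrib_left times_divide_eq_right)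

lemma avg_abs_le_rms:
  assumes "finite A" "A \<noteq> {}"
  shows "avg A (\<lambda>a. \<bar>f a\<bar>) \<le> rms A f"
proof -
  have c: "0 < real (card A)" using assms by (simp add: card_gt_0_iff)
  have "(\<Sum>a\<in>A. \<bar>f a\<bar> * \<bar>1\<bar>) \<le> L2_set f A * L2_set (\<lambda>_. 1) A"
    by (rule L2_set_mult_ineq)
  also have "L2_set (\<lambda>_. 1::real) A = sqrt (card A)" by (simp add: L2_set_def)
  finally have "avg A (\<lambda>a. \<bar>f a\<bar>) \<le> L2_set f A * sqrt (card A) / (sqrt (card A) * sqrt (card A))"
    using c by (simp add: avg_def divide_right_mono)
  also have "\<dots> = rms A f" using c unfolding rms_L2_set by (simp add: field_simps)
  finally show ?thesis .
qed

lemma avg_power2_centred_le: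
  fixes f :: "'a \<Rightarrow> real"
  assumes "finite A" "A \<noteq> {}"
  shows "avg A (\<lambda>a. (f a - avg A f)\<^sup>2) \<le> avg A (\<lambda>a. (f a)\<^sup>2)"
  using sum_power2_shift[OF assms, of f 0] by (simp add: avg_def divide_right_mono)

lemma rms_centred_le:
  assumes "finite A" "A \<noteq> {}"
  shows "rms A (\<lambda>a. f a - avg A f) \<le> rms A f"
  using avg_power2_centred_le[OF assms] by (simp add: rms_def)

text \<open>
  A perturbation \<open>R\<close> that is small in mean square compared with the variance \<open>V\<close> of \<open>X\<close> hardly
  changes the characteristic function of the standardized variable: both the centring and the
  standard deviation move by at most the relative size of \<open>R\<close>.
\<close>

lemma avg_iexp_standardized_diff_le:
  fixes X R T :: "'a \<Rightarrow> real"
  assumes A: "finite A" "A \<noteq> {}" and X0: "avg A X = 0" and X2: "avg A (\<lambda>a. (X a)\<^sup>2) = V" and V: "0 < V"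
    and T: "\<And>a. a \<in> A \<Longrightarrow> T a = X a - R a + c"
    and small: "avg A (\<lambda>a. (R a)\<^sup>2) / V < 1"
  shows "cmod (avg A (\<lambda>a. iexp (t * ((T a - avg A T) / sqrt (avg A (\<lambda>a. (T a - avg A T)\<^sup>2)))))
      - avg A (\<lambda>a. iexp (t * (X a / sqrt V)))) \<le> 2 * \<bar>t\<bar> * sqrt (avg A (\<lambda>a. (R a)\<^sup>2) / V)"
proof -
  let ?q = "sqrt (avg A (\<lambda>a. (R a)\<^sup>2) / V)"
  have N: "card A \<noteq> 0" using A by simp
  define x where "x = (\<lambda>a. X a / sqrt V)"
  define r where "r = (\<lambda>a. (R a - avg A R) / sqrt V)"
  define s where "s = rms A (\<lambda>a. x a - r a)"
  have "avg A T = avg A (\<lambda>a. X a - R a + c)"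
    using T by (rule avg_cong)
  also have "\<dots> = - avg A R + c"
    using X0 N by (simp add: avg_def sum.distrib sum_subtractf add_divide_distrib diff_divide_distrib)
  finally have avgT: "avg A T = - avg A R + c" .
  have T': "T a - avg A T = sqrt V * (x a - r a)" if "a \<in> A" for a
  proof -
    have "x a - r a = (X a - (R a - avg A R)) / sqrt V"
      by (simp add: x_def r_def diff_divide_distrib)
    then show ?thesis using V T[OF that] by (simp add: avgT)
  qed
  have "rms A (\<lambda>a. T a - avg A T) = rms A (\<lambda>a. sqrt V * (x a - r a))"
    by (rule rms_cong) (rule T')
  then have sdT: "sqrt (avg A (\<lambda>a. (T a - avg A T)\<^sup>2)) = sqrt V * s"
    using V by (simp add: rms_cmult s_def flip: rms_def)
  have x1: "rms A x = 1"
  proof -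
    have "avg A (\<lambda>a. (x a)\<^sup>2) = avg A (\<lambda>a. (X a)\<^sup>2) / V"
      using V by (simp add: avg_def x_def power_divide flip: sum_divide_distrib)
    then show ?thesis using X2 V by (simp add: rms_def)
  qed
  have rq: "rms A r \<le> ?q"
  proof -
    have "rms A r = rms A (\<lambda>a. (1 / sqrt V) * (R a - avg A R))" by (simp add: r_def)
    also have "\<dots> \<le> (1 / sqrt V) * rms A R"
      unfolding rms_cmult using V rms_centred_le[OF A, of R] by (simp add: mult_left_mono divide_right_mono)
    also have "\<dots> = ?q" by (simp add: rms_def real_sqrt_divide)
    finally show ?thesis .
  qed
  have "rms A (\<lambda>a. - 1 * r a) = rms A r" by (subst rms_cmult) simp
  then have "s \<le> 1 + rms A r" unfolding s_def using rms_triangle[of A x "\<lambda>a. - 1 * r a"] x1 by simp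
  moreover have "1 \<le> s + rms A r"
    unfolding s_def using rms_triangle[of A "\<lambda>a. x a - r a" r] x1 by simp
  ultimately have s1: "\<bar>1 - s\<bar> \<le> ?q" using rq by linarith
  have "?q < 1" using small by (simp add: real_sqrt_lt_1_iff)
  then have s: "0 < s" using s1 by linarith
  define \<tau> where "\<tau> = (\<lambda>a. (x a - r a) / s)"
  have "rms A (\<lambda>a. \<tau> a - x a) = rms A (\<lambda>a. (1 / s - 1) * (x a - r a) + - 1 * r a)"
    using s by (intro arg_cong[of _ _ "rms A"]) (auto simp: \<tau>_def field_simps)
  also have "\<dots> \<le> rms A (\<lambda>a. (1 / s - 1) * (x a - r a)) + rms A (\<lambda>a. - 1 * r a)"
    by (rule rms_triangle)
  also have "\<dots> = \<bar>1 / s - 1\<bar> * s + rms A r"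
    unfolding rms_cmult by (simp add: s_def)
  also have "\<bar>1 / s - 1\<bar> * s = \<bar>(1 / s - 1) * s\<bar>" using s by (simp add: abs_mult)
  also have "(1 / s - 1) * s = 1 - s" using s by (simp add: field_simps)
  finally have diff: "rms A (\<lambda>a. \<tau> a - x a) \<le> 2 * ?q" using s1 rq by linarith
  have standardized: "avg A (\<lambda>a. iexp (t * ((T a - avg A T) / sqrt (avg A (\<lambda>a. (T a - avg A T)\<^sup>2)))))
      = avg A (\<lambda>a. iexp (t * \<tau> a))"
    unfolding sdT using V s by (intro avg_cong) (simp add: T' \<tau>_def)
  have "cmod (avg A (\<lambda>a. iexp (t * \<tau> a)) - avg A (\<lambda>a. iexp (t * x a)))
      = cmod (\<Sum>a\<in>A. iexp (t * \<tau> a) - iexp (t * x a)) / card A"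
    unfolding avg_def diff_divide_distrib[symmetric] sum_subtractf[symmetric]
    by (simp only: norm_divide norm_of_nat)
  also have "\<dots> \<le> (\<Sum>a\<in>A. \<bar>t\<bar> * \<bar>\<tau> a - x a\<bar>) / card A"
  proof (intro divide_right_mono sum_norm_le)
    fix a
    show "cmod (iexp (t * \<tau> a) - iexp (t * x a)) \<le> \<bar>t\<bar> * \<bar>\<tau> a - x a\<bar>"
      using cmod_iexp_diff_le[of "t * \<tau> a" "t * x a"] by (simp add: abs_mult flip: right_diff_distrib)
  qed simp
  also have "\<dots> = \<bar>t\<bar> * avg A (\<lambda>a. \<bar>\<tau> a - x a\<bar>)"
    by (simp add: avg_def sum_distrib_left)
  also have "\<dots> \<le> \<bar>t\<bar> * (2 * ?q)"
    using avg_abs_le_rms[OF A, of "\<lambda>a. \<tau> a - x a"] diff by (intro mult_left_mono) auto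
  finally show ?thesis unfolding standardized x_def by (simp only: mult_ac)
qed

section \<open>Limits of characteristic functions\<close>

lemma power4_le_exp: "(x::real) ^ 4 \<le> 24 * (exp x + exp (- x))"
proof -
  have *: "y ^ 4 \<le> 24 * exp y" if "0 \<le> y" for y :: real
  proof -
    have "(\<Sum>n\<in>{4}. y ^ n /\<^sub>R fact n) \<le> exp y"
      unfolding exp_def using that by (intro sum_le_suminf summable_exp_generic) auto
    then show ?thesis by (simp add: fact_numeral field_simps)
  qed
  show ?thesis
  proof (cases "0 \<le> x")
    case True
    then show ?thesis using *[of x] exp_ge_zero[of "- x"] by argo
  next
    case False
    then have "(- x) ^ 4 \<le> 24 * exp (- x)" by (intro *) simp
    then have "x ^ 4 \<le> 24 * exp (- x)" by simp
    also have "\<dots> \<le> 24 * (exp x + exp (- x))" by simp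
    finally show ?thesis .
  qed
qed

lemma integral_pmf_of_set_eq_avg:
  fixes f :: "'a \<Rightarrow> 'b::{banach, second_countable_topology, real_normed_field}"
  assumes "finite A" "A \<noteq> {}"
  shows "(LINT x|measure_pmf (pmf_of_set A). f x) = avg A f"
proof -
  have "(LINT x|measure_pmf (pmf_of_set A). f x) = (\<Sum>a\<in>A. pmf (pmf_of_set A) a *\<^sub>R f a)"
    using assms by (intro integral_measure_pmf) auto
  also have "\<dots> = (\<Sum>a\<in>A. f a / of_nat (card A))"
    using assms by (intro sum.cong refl) (simp add: scaleR_conv_of_real divide_inverse)
  finally show ?thesis by (simp add: avg_def sum_divide_distrib)
qed

lemma asymptotically_normal_pmf_of_set:
  fixes A :: "nat \<Rightarrow> 'a set" and S :: "nat \<Rightarrow> 'a \<Rightarrow> real"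
  assumes A: "\<forall>\<^sub>F n in sequentially. finite (A n) \<and> A n \<noteq> {}"
    and lim: "\<And>t. (\<lambda>n. avg (A n) (\<lambda>a. iexp (t * ((S n a - avg (A n) (S n)) /
        sqrt (avg (A n) (\<lambda>a. (S n a - avg (A n) (S n))\<^sup>2)))))) \<longlonglongrightarrow> of_real (exp (- (t\<^sup>2) / 2))"
  shows "asymptotically_normal (\<lambda>n. pmf_of_set (A n)) S"
  unfolding asymptotically_normal_def
proof (rule levy_continuity)
  show "real_distribution std_normal_distribution" by (rule real_dist_normal_dist)
  let ?Z = "\<lambda>n x. (S n x - measure_pmf.expectation (pmf_of_set (A n)) (S n))
      / sqrt (measure_pmf.variance (pmf_of_set (A n)) (S n))"
  show "real_distribution (distr (measure_pmf (pmf_of_set (A n))) borel (?Z n))" for n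
    by (intro prob_space.real_distribution_distr measure_pmf.prob_space_axioms) simp
  fix t :: real
  have "\<forall>\<^sub>F n in sequentially. avg (A n) (\<lambda>a. iexp (t * ((S n a - avg (A n) (S n)) /
        sqrt (avg (A n) (\<lambda>a. (S n a - avg (A n) (S n))\<^sup>2))))) =
      char (distr (measure_pmf (pmf_of_set (A n))) borel (?Z n)) t"
    using A
  proof eventually_elim
    case (elim n)
    then have fin: "finite (A n)" "A n \<noteq> {}" by auto
    have "char (distr (measure_pmf (pmf_of_set (A n))) borel (?Z n)) t
        = (LINT x|measure_pmf (pmf_of_set (A n)). iexp (t * ?Z n x))"
      unfolding char_def by (subst integral_distr) auto
    then show ?case by (simp add: integral_pmf_of_set_eq_avg[OF fin])
  qed
  with lim[of t] have "(\<lambda>n. char (distr (measure_pmf (pmf_of_set (A n))) borel (?Z n)) t)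
      \<longlonglongrightarrow> of_real (exp (- (t\<^sup>2) / 2))"
    by (rule Lim_transform_eventually)
  then show "(\<lambda>n. char (distr (measure_pmf (pmf_of_set (A n))) borel (?Z n)) t)
      \<longlonglongrightarrow> char std_normal_distribution t"
    by (simp add: char_std_normal_distribution)
qed

lemma cgf_const_pos: "0 < cgf_const d"
  unfolding cgf_const_def by (intro add_nonneg_pos mult_nonneg_nonneg add_nonneg_nonneg) (auto simp: ln_ge_zero)

lemma cgf_radius_pos: "0 < M \<Longrightarrow> 0 < cgf_radius d M"
  by (simp add: cgf_radius_def)

lemma cgf_radius_mult: "cgf_radius d (M * x) = cgf_radius d M / x"
  by (simp add: cgf_radius_def)

text \<open>
  The fourth central moment of the number of parts is at most of order \<open>k\<^sup>2\<close>, because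
  the exponential moments at the points \<open>\<plusminus>1 / sqrt k\<close> are bounded uniformly in \<open>k\<close>.
\<close>

lemma length_fourth_moment:
  obtains C where "\<forall>\<^sub>F k in sequentially. avg (sparse_seqs d k) (\<lambda>a.
    (lin_stat (\<lambda>_. real) k a - avg (sparse_seqs d k) (lin_stat (\<lambda>_. real) k)) ^ 4) \<le> C * (real k)\<^sup>2"
proof -
  define \<rho> where "\<rho> = cgf_radius d (real d + 1)"
  define K where "K = cgf_const d"
  have \<rho>: "0 < \<rho>" and K: "0 < K" by (simp_all add: \<rho>_def K_def cgf_radius_pos cgf_const_pos)
  \<comment> \<open>The summands bound the quadratic and the cubic term of the expansion at \<open>\<bar>z\<bar> = 1 / sqrt k\<close>.\<close>
  define E where "E = exp (4 * K / \<rho>\<^sup>2 + 24 * K / \<rho> ^ 3)"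
  have "LIM k sequentially. sqrt (real k) :> at_top"
    by (rule filterlim_compose[OF sqrt_at_top filterlim_real_sequentially])
  then have "\<forall>\<^sub>F k in sequentially. 2 / \<rho> < sqrt (real k)"
    by (simp add: filterlim_at_top_dense)
  then have "\<forall>\<^sub>F k in sequentially. avg (sparse_seqs d k) (\<lambda>a.
    (lin_stat (\<lambda>_. real) k a - avg (sparse_seqs d k) (lin_stat (\<lambda>_. real) k)) ^ 4) \<le> 48 * E * (real k)\<^sup>2"
    using eventually_gt_at_top[of 0]
  proof eventually_elim
    case (elim k)
    let ?A = "sparse_seqs d k" and ?s = "sqrt (real k)"
    define X where "X = (\<lambda>a. lin_stat (\<lambda>_. real) k a - avg ?A (lin_stat (\<lambda>_. real) k))"
    define V where "V = avg ?A (\<lambda>a. (X a)\<^sup>2)"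
    have s: "1 \<le> ?s" "?s * ?s = k" using elim by auto
    have V0: "0 \<le> V" by (simp add: V_def avg_def sum_nonneg)
    note gen = lin_stat_moment_generating[of "\<lambda>_. real" k d "real d + 1" X V, folded \<rho>_def K_def]
    have V: "V \<le> 8 * (K * k) / \<rho>\<^sup>2" by (rule gen(1)) (auto simp: X_def V_def)
    have exp_le: "avg ?A (\<lambda>a. exp (y * X a)) \<le> E" if y: "\<bar>y\<bar> = 1 / ?s" for y
    proof -
      have "1 / ?s < \<rho> / 2" using elim(1) \<rho> s by (simp add: field_simps)
      then have "cmod (of_real y) < \<rho> / 2" using y by simp
      then obtain e where e: "cmod e \<le> 24 * (K * k) * (cmod (of_real y) / \<rho>) ^ 3"
        "avg ?A (\<lambda>a. exp (of_real y * of_real (X a))) = exp (of_real V * (of_real y)\<^sup>2 / 2 + e)"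
        using gen(2)[of "of_real y"] by (auto simp: X_def V_def)
      have "avg ?A (\<lambda>a. exp (of_real y * of_real (X a)) :: complex) = of_real (avg ?A (\<lambda>a. exp (y * X a)))"
        by (simp add: avg_def exp_of_real flip: of_real_mult)
      then have "avg ?A (\<lambda>a. exp (y * X a)) \<le> cmod (exp (of_real V * (of_real y)\<^sup>2 / 2 + e))"
        using e(2) by (metis abs_ge_self norm_of_real)
      also have "\<dots> \<le> exp (cmod (of_real V * (of_real y)\<^sup>2 / 2 + e))" by (rule norm_exp)
      also have "\<dots> \<le> E"
      proof -
        have y2: "y\<^sup>2 = 1 / k"
        proof -
          have "y\<^sup>2 = \<bar>y\<bar>\<^sup>2" by simp
          then show ?thesis using s(2) unfolding y by (simp add: power_divide)
        qed
        have "cmod (of_real V * (of_real y)\<^sup>2 / 2) = V * y\<^sup>2 / 2"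
          using V0 by (simp add: norm_mult norm_divide norm_power)
        also have "\<dots> \<le> 8 * (K * k) / \<rho>\<^sup>2 * y\<^sup>2 / 2"
          using V by (intro divide_right_mono mult_right_mono) auto
        also have "\<dots> = 4 * K / \<rho>\<^sup>2" using elim(2) by (simp add: y2)
        finally have 1: "cmod (of_real V * (of_real y)\<^sup>2 / 2) \<le> 4 * K / \<rho>\<^sup>2" .
        have "24 * (K * k) * (cmod (of_real y) / \<rho>) ^ 3 = 24 * K / \<rho> ^ 3 * (?s * ?s * \<bar>y\<bar> ^ 3)"
          unfolding s(2) by (simp add: power_divide)
        also have "?s * ?s * \<bar>y\<bar> ^ 3 = 1 / ?s" unfolding y using s(1) by (simp add: power_divide power3_eq_cube)
        also have "24 * K / \<rho> ^ 3 * (1 / ?s) \<le> 24 * K / \<rho> ^ 3 * 1"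
          using s(1) K \<rho> by (intro mult_left_mono) auto
        finally have "cmod e \<le> 24 * K / \<rho> ^ 3" using e(1) by simp
        then have "cmod (of_real V * (of_real y)\<^sup>2 / 2 + e) \<le> 4 * K / \<rho>\<^sup>2 + 24 * K / \<rho> ^ 3"
          using 1 norm_triangle_ineq[of "of_real V * (of_real y)\<^sup>2 / 2" e] by linarith
        then show ?thesis by (simp add: E_def)
      qed
      finally show ?thesis .
    qed
    have "avg ?A (\<lambda>a. (X a) ^ 4) \<le> avg ?A (\<lambda>a. (real k)\<^sup>2 * (24 * (exp (1 / ?s * X a) + exp (- 1 / ?s * X a))))"
      unfolding avg_def
    proof (intro divide_right_mono sum_mono)
      fix a
      have "(X a) ^ 4 = (?s * ?s)\<^sup>2 * (1 / ?s * X a) ^ 4"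
        using s(1) by (simp add: power_divide power_mult_distrib field_simps eval_nat_numeral)
      also have "\<dots> \<le> (?s * ?s)\<^sup>2 * (24 * (exp (1 / ?s * X a) + exp (- (1 / ?s * X a))))"
        by (intro mult_left_mono power4_le_exp) simp
      finally show "(X a) ^ 4 \<le> (real k)\<^sup>2 * (24 * (exp (1 / ?s * X a) + exp (- 1 / ?s * X a)))"
        by (simp add: s(2))
    qed simp
    also have "\<dots> = (real k)\<^sup>2 * 24 * (avg ?A (\<lambda>a. exp (1 / ?s * X a)) + avg ?A (\<lambda>a. exp (- 1 / ?s * X a)))"
      unfolding avg_def
      by (simp add: sum.distrib flip: sum_distrib_left) (simp add: distrib_left add_divide_distrib)
    also have "\<dots> \<le> (real k)\<^sup>2 * 24 * (E + E)"
      using s(1) by (intro mult_left_mono add_mono exp_le) auto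
    finally show ?case by (simp add: X_def mult_ac)
  qed
  then show ?thesis by (rule that)
qed

text \<open>
  A central limit theorem for additive statistics: contributions of order at most \<open>k\<close> and a
  variance of order at least \<open>k\<^sup>3\<close> make the cubic error term in the cumulant generating function, taken at
  \<open>\<i> t / sqrt V\<close>, of order at most \<open>1 / sqrt k\<close>.
\<close>

lemma lin_stat_char_limit:
  fixes g :: "nat \<Rightarrow> nat \<Rightarrow> nat \<Rightarrow> real" and M c t :: real
  assumes g0: "\<And>k i. g k i 0 = 0" and M: "0 < M"
    and gM: "\<And>k i u. 1 \<le> k \<Longrightarrow> 1 \<le> i \<Longrightarrow> i \<le> k \<Longrightarrow> 1 \<le> u \<Longrightarrow> u \<le> d \<Longrightarrow> \<bar>g k i u\<bar> \<le> M * k"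
  defines "X \<equiv> \<lambda>k a. lin_stat (g k) k a - avg (sparse_seqs d k) (lin_stat (g k) k)"
  defines "V \<equiv> \<lambda>k. avg (sparse_seqs d k) (\<lambda>a. (X k a)\<^sup>2)"
  assumes c: "0 < c" and V: "\<forall>\<^sub>F k in sequentially. c * real k ^ 3 \<le> V k"
  shows "(\<lambda>k. avg (sparse_seqs d k) (\<lambda>a. iexp (t * (X k a / sqrt (V k))))) \<longlonglongrightarrow> of_real (exp (- (t\<^sup>2) / 2))"
proof -
  define r where "r = cgf_radius d M"
  define K where "K = cgf_const d"
  have r: "0 < r" and K: "0 < K" using M by (simp_all add: r_def K_def cgf_radius_pos cgf_const_pos)
  define B where "B = \<bar>t\<bar> / (r * sqrt c)"
  have B: "0 \<le> B" using r c by (simp add: B_def)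
  let ?\<Phi> = "\<lambda>k. avg (sparse_seqs d k) (\<lambda>a. iexp (t * (X k a / sqrt (V k))))"
  have sq: "LIM k sequentially. sqrt (real k) :> at_top"
    by (rule filterlim_compose[OF sqrt_at_top filterlim_real_sequentially])
  then have "\<forall>\<^sub>F k in sequentially. 2 * B < sqrt (real k)"
    by (simp add: filterlim_at_top_dense)
  then have "\<forall>\<^sub>F k in sequentially. \<exists>e. cmod e \<le> 24 * K * B ^ 3 * (1 / sqrt (real k)) \<and>
      ?\<Phi> k = exp (of_real (- (t\<^sup>2) / 2) + e)"
    using V eventually_gt_at_top[of 0]
  proof eventually_elim
    case (elim k)
    let ?s = "sqrt (real k)"
    have s: "0 < ?s" "?s * ?s = k" using elim by auto
    have V0: "0 < V k"
    proof -
      have "0 < c * real k ^ 3" using c elim(3) by simp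
      then show ?thesis using elim(2) by linarith
    qed
    define z where "z = \<i> * of_real (t / sqrt (V k))"
    have "sqrt c * ?s ^ 3 = sqrt (c * real k ^ 3)" by (simp add: real_sqrt_mult real_sqrt_power)
    also have "\<dots> \<le> sqrt (V k)" using elim(2) by simp
    finally have sV: "sqrt c * ?s ^ 3 \<le> sqrt (V k)" .
    have "cmod z / (r / k) = \<bar>t\<bar> * k / (r * sqrt (V k))"
      using V0 by (simp add: z_def norm_mult norm_divide)
    also have "\<dots> \<le> \<bar>t\<bar> * k / (r * (sqrt c * ?s ^ 3))"
      using sV r c s V0 by (intro divide_left_mono mult_left_mono mult_pos_pos) auto
    also have "\<dots> = \<bar>t\<bar> * (?s * ?s) / (r * (sqrt c * ?s ^ 3))" by (simp only: s(2))
    also have "\<dots> = B / ?s"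
      using s(1) by (simp add: B_def power3_eq_cube)
    finally have zr: "cmod z / (r / k) \<le> B / ?s" .
    have rk: "0 < r / k" using r elim by simp
    have "B / ?s < 1 / 2" using elim(1) s by (simp add: divide_less_eq)
    then have "cmod z / (r / k) < 1 / 2" using zr by linarith
    then have "cmod z < 1 / 2 * (r / k)" using rk by (simp only: pos_divide_less_eq)
    then have z: "cmod z < r / k / 2" by simp
    note gen = lin_stat_moment_generating[of "g k" k d "M * k" "X k" "V k", unfolded cgf_radius_mult, folded r_def K_def]
    have "\<exists>e. cmod e \<le> 24 * (K * k) * (cmod z / (r / k)) ^ 3 \<and>
      avg (sparse_seqs d k) (\<lambda>a. exp (z * of_real (X k a))) = exp (of_real (V k) * z\<^sup>2 / 2 + e)"
      by (rule gen(2)) (use g0 gM M elim z in \<open>auto simp: X_def V_def\<close>)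
    then obtain e where e: "cmod e \<le> 24 * (K * k) * (cmod z / (r / k)) ^ 3"
      "avg (sparse_seqs d k) (\<lambda>a. exp (z * of_real (X k a))) = exp (of_real (V k) * z\<^sup>2 / 2 + e)"
      by blast
    have "cmod e \<le> 24 * (K * k) * (B / ?s) ^ 3"
      using e(1) zr K r rk by (elim order_trans) (intro mult_left_mono power_mono, auto)
    also have "\<dots> = 24 * K * B ^ 3 * (?s * ?s / ?s ^ 3)" unfolding s(2) by (simp add: power_divide)
    also have "?s * ?s / ?s ^ 3 = 1 / ?s" using s(1) by (simp add: power3_eq_cube)
    finally have le: "cmod e \<le> 24 * K * B ^ 3 * (1 / ?s)" .
    have "of_real (V k) * z\<^sup>2 / 2 = of_real (- (t\<^sup>2) / 2)"
    proof -
      have "(t / sqrt (V k))\<^sup>2 = t\<^sup>2 / V k" using V0 by (simp add: power_divide)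
      then have "z\<^sup>2 = - of_real (t\<^sup>2 / V k)"
        unfolding z_def power_mult_distrib by (metis mult_minus1 of_real_power power2_i)
      then show ?thesis using V0 by simp
    qed
    moreover have "(\<lambda>a. exp (z * of_real (X k a))) = (\<lambda>a. iexp (t * (X k a / sqrt (V k))))"
      by (simp add: z_def mult_ac)
    ultimately show ?case using e(2) le by auto
  qed
  then obtain e where e: "\<forall>\<^sub>F k in sequentially. cmod (e k) \<le> 24 * K * B ^ 3 * (1 / sqrt (real k)) \<and>
      ?\<Phi> k = exp (of_real (- (t\<^sup>2) / 2) + e k)"
    unfolding eventually_ex by blast
  have "(\<lambda>k. 1 / sqrt (real k)) \<longlonglongrightarrow> 0"
    using tendsto_divide_0[OF tendsto_const filterlim_at_top_imp_at_infinity[OF sq]] .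
  then have "(\<lambda>k. 24 * K * B ^ 3 * (1 / sqrt (real k))) \<longlonglongrightarrow> 0"
    by (rule tendsto_mult_right_zero)
  then have "e \<longlonglongrightarrow> 0"
    by (rule Lim_null_comparison[rotated]) (use e in \<open>auto elim: eventually_mono\<close>)
  then have "(\<lambda>k. exp (of_real (- (t\<^sup>2) / 2) + e k)) \<longlonglongrightarrow> exp (of_real (- (t\<^sup>2) / 2) + 0)"
    by (intro tendsto_intros)
  then have "?\<Phi> \<longlonglongrightarrow> exp (of_real (- (t\<^sup>2) / 2) + 0)"
    by (rule Lim_transform_eventually) (use e in \<open>auto elim: eventually_mono\<close>)
  then show ?thesis by (simp only: add_0_right exp_of_real)
qed

section \<open>Asymptotic normality of the size\<close>

text \<open>
  Three values with a non-zero second difference cannot all be close to a common centre.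
\<close>

lemma sum_power2_ge_second_difference:
  fixes h :: "nat \<Rightarrow> real"
  assumes d: "3 \<le> d" and h: "h 3 - 2 * h 2 + h 1 = b"
  shows "b\<^sup>2 / 6 \<le> (\<Sum>u=1..d. (h u - c)\<^sup>2)"
proof -
  have "b = (h 3 - c) - 2 * (h 2 - c) + (h 1 - c)" using h by simp
  then have "b\<^sup>2 \<le> 6 * ((h 3 - c)\<^sup>2 + (h 2 - c)\<^sup>2 + (h 1 - c)\<^sup>2)"
  proof -
    have *: "(x - 2 * y + z)\<^sup>2 \<le> 6 * (x\<^sup>2 + y\<^sup>2 + z\<^sup>2)" for x y z :: real
    proof -
      \<comment> \<open>The constant is the sum \<open>1 + 4 + 1\<close> of the squared coefficients.\<close>
      have "6 * (x\<^sup>2 + y\<^sup>2 + z\<^sup>2) - (x - 2 * y + z)\<^sup>2 = (2 * x + y)\<^sup>2 + (x - z)\<^sup>2 + (y + 2 * z)\<^sup>2"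
        by (simp add: power2_eq_square algebra_simps)
      then show ?thesis by (metis add_nonneg_nonneg diff_ge_0_iff_ge zero_le_power2)
    qed
    show ?thesis unfolding \<open>b = _\<close> by (rule *)
  qed
  also have "(h 3 - c)\<^sup>2 + (h 2 - c)\<^sup>2 + (h 1 - c)\<^sup>2 = (\<Sum>u\<in>{1, 2, 3}. (h u - c)\<^sup>2)" by simp
  also have "\<dots> \<le> (\<Sum>u=1..d. (h u - c)\<^sup>2)"
    by (rule sum_mono2) (use d in auto)
  finally show ?thesis by simp
qed

text \<open>
  With the mean \<open>m\<close> of the number \<open>l\<close> of parts, \<open>l (l - 1) / 2 = (l - m)\<^sup>2 / 2 + (m - 1/2) l - m\<^sup>2 / 2\<close>.
  Hence the size is an additive statistic, minus \<open>(l - m)\<^sup>2 / 2\<close>, plus a constant. The additive part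
  has variance of order at least \<open>k\<^sup>3\<close>, since the second difference of \<open>u (u - 1) / 2\<close> at the values 1, 2, 3
  does not vanish, whereas the mean square of the quadratic part is at most of order \<open>k\<^sup>2\<close>.
\<close>

lemma core_stat_char_limit:
  assumes d: "3 \<le> d"
  defines "S \<equiv> core_stat" and "A \<equiv> sparse_seqs d"
  shows "(\<lambda>k. avg (A k) (\<lambda>a. iexp (t * ((S k a - avg (A k) (S k)) /
        sqrt (avg (A k) (\<lambda>a. (S k a - avg (A k) (S k))\<^sup>2)))))) \<longlonglongrightarrow> of_real (exp (- (t\<^sup>2) / 2))"
proof -
  define L where "L = (\<lambda>k. lin_stat (\<lambda>_. real) k)"
  define m where "m = (\<lambda>k. avg (A k) (L k))"
  define g where "g = (\<lambda>k i u. real i * real u + real (Suc k) * (real u * (real u - 1) / 2) - (m k - 1 / 2) * real u)"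
  define X where "X = (\<lambda>k a. lin_stat (g k) k a - avg (A k) (lin_stat (g k) k))"
  define V where "V = (\<lambda>k. avg (A k) (\<lambda>a. (X k a)\<^sup>2))"
  define R where "R = (\<lambda>k a. (L k a - m k)\<^sup>2 / 2)"
  \<comment> \<open>The three terms of \<open>g k i u\<close> are bounded by \<open>k d\<close>, \<open>k d\<^sup>2\<close> and \<open>k d\<^sup>2 + k d\<close>.\<close>
  define M where "M = 2 * real d + 2 * (real d)\<^sup>2"
  \<comment> \<open>The factor 12 is 6, from the second difference, times 2, from \<open>k - 1 \<ge> k / 2\<close>.\<close>
  define c where "c = 1 / (12 * (1 + 3 * real d))"
  have A: "finite (A k)" "A k \<noteq> {}" "0 < card (A k)" for k by (simp_all add: A_def)
  have M: "0 < M" using d by (simp add: M_def add_pos_nonneg)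
  have c: "0 < c" by (simp add: c_def)
  have g0: "g k i 0 = 0" for k i by (simp add: g_def)
  have m_bounds: "0 \<le> m k \<and> m k \<le> k * d" for k
  proof
    have "0 \<le> (\<Sum>a\<in>A k. L k a)" by (simp add: L_def lin_stat_def sum_nonneg)
    then show "0 \<le> m k" by (simp add: m_def avg_def)
    have "L k a \<le> k * d" if "a \<in> A k" for a
      using abs_lin_stat_le[of "\<lambda>_. real" k d "real d" a] that by (simp add: L_def A_def)
    then have "(\<Sum>a\<in>A k. L k a) \<le> (\<Sum>a\<in>A k. real (k * d))" by (intro sum_mono) simp
    then show "m k \<le> k * d" using A(3)[of k] by (simp add: m_def avg_def divide_le_eq mult.commute)
  qed
  have gM: "\<bar>g k i u\<bar> \<le> M * k" if "1 \<le> k" "1 \<le> i" "i \<le> k" "1 \<le> u" "u \<le> d" for k i u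
  proof -
    have k1: "1 \<le> real k" and u: "0 \<le> real u" "real u \<le> d" "1 \<le> real u" using that by auto
    have "\<bar>real i * real u\<bar> \<le> real k * real d"
      using that by (simp add: abs_mult mult_mono)
    moreover have "\<bar>real (Suc k) * (real u * (real u - 1) / 2)\<bar> \<le> real k * (real d)\<^sup>2"
    proof -
      have "real (Suc k) * (real u * (real u - 1) / 2) \<le> (2 * real k) * (real d * real d / 2)"
        using k1 u by (intro mult_mono divide_right_mono) auto
      then show ?thesis using u by (simp add: abs_of_nonneg power2_eq_square)
    qed
    moreover have "\<bar>(m k - 1 / 2) * real u\<bar> \<le> (real k * d + real k) * real d"
      unfolding abs_mult using m_bounds[of k] k1 u by (intro mult_mono) (auto simp: abs_le_iff)
    ultimately have "\<bar>g k i u\<bar> \<le> real k * real d + real k * (real d)\<^sup>2 + (real k * d + real k) * real d"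
      unfolding g_def by linarith
    also have "\<dots> = M * k" by (simp add: M_def algebra_simps power2_eq_square)
    finally show ?thesis .
  qed
  have V_ge: "c * real k ^ 3 \<le> V k" if k: "2 \<le> k" for k
  proof -
    define v where "v = (real (Suc k))\<^sup>2 / 6"
    have "v \<le> (\<Sum>u=1..d. (g k i u - c')\<^sup>2)" for i c'
      unfolding v_def using d by (rule sum_power2_ge_second_difference) (simp add: g_def algebra_simps)
    then have "card (A k) * (v / (1 + 3 * real d) * (real k - 1)) \<le> (\<Sum>a\<in>A k. (X k a)\<^sup>2)"
      unfolding X_def A_def using d g0 by (intro sum_power2_lin_stat_ge[where g = "g k" and n = k]) (auto simp: v_def)
    then have "v / (1 + 3 * real d) * (real k - 1) \<le> V k"
      using A(3)[of k] by (simp add: V_def avg_def le_divide_eq mult.commute)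
    moreover have "c * real k ^ 3 \<le> v / (1 + 3 * real d) * (real k - 1)"
    proof -
      have "(real k)\<^sup>2 * (real k / 2) \<le> (real (Suc k))\<^sup>2 * (real k - 1)"
        using k by (intro mult_mono power_mono) auto
      then have "(real k)\<^sup>2 * (real k / 2) / (6 * (1 + 3 * real d)) \<le> (real (Suc k))\<^sup>2 * (real k - 1) / (6 * (1 + 3 * real d))"
        by (rule divide_right_mono) simp
      then show ?thesis by (simp add: c_def v_def power2_eq_square power3_eq_cube mult_ac)
    qed
    ultimately show ?thesis by linarith
  qed
  then have V_ev: "\<forall>\<^sub>F k in sequentially. c * real k ^ 3 \<le> V k"
    by (auto simp: eventually_sequentially)
  have clt: "(\<lambda>k. avg (A k) (\<lambda>a. iexp (t * (X k a / sqrt (V k))))) \<longlonglongrightarrow> of_real (exp (- (t\<^sup>2) / 2))"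
    unfolding V_def X_def A_def
    by (rule lin_stat_char_limit[where g = g, OF g0 M gM c]) (use V_ev in \<open>auto simp: V_def X_def A_def\<close>)
  obtain C where "\<forall>\<^sub>F k in sequentially. avg (A k) (\<lambda>a. (L k a - m k) ^ 4) \<le> C * (real k)\<^sup>2"
    using length_fourth_moment[of d] unfolding A_def L_def m_def by blast
  then have q_ev: "\<forall>\<^sub>F k in sequentially. 0 < V k \<and> avg (A k) (\<lambda>a. (R k a)\<^sup>2) / V k \<le> C / (4 * c) * (1 / real k)"
    using V_ev eventually_gt_at_top[of 0]
  proof eventually_elim
    case (elim k)
    have ck: "0 < c * real k ^ 3" using c elim by simp
    have "avg (A k) (\<lambda>a. (R k a)\<^sup>2) = avg (A k) (\<lambda>a. (L k a - m k) ^ 4) / 4"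
      by (simp add: avg_def R_def power_divide flip: sum_divide_distrib power_mult)
    also have "\<dots> \<le> C * (real k)\<^sup>2 / 4" using elim by simp
    finally have R2: "avg (A k) (\<lambda>a. (R k a)\<^sup>2) \<le> C * (real k)\<^sup>2 / 4" .
    have "0 \<le> avg (A k) (\<lambda>a. (R k a)\<^sup>2)" by (simp add: avg_def sum_nonneg)
    then have "avg (A k) (\<lambda>a. (R k a)\<^sup>2) / V k \<le> (C * (real k)\<^sup>2 / 4) / (c * real k ^ 3)"
      using R2 elim ck by (intro frac_le) auto
    also have "\<dots> = C / (4 * c) * (1 / real k)"
      using elim(3) by (simp add: power2_eq_square power3_eq_cube)
    finally show ?case using ck elim by simp
  qed
  have lim0: "(\<lambda>k. C / (4 * c) * (1 / real k)) \<longlonglongrightarrow> 0"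
    by (intro tendsto_mult_right_zero lim_1_over_n)
  have "(\<lambda>k. avg (A k) (\<lambda>a. (R k a)\<^sup>2) / V k) \<longlonglongrightarrow> 0"
  proof (rule Lim_null_comparison[OF _ lim0])
    show "\<forall>\<^sub>F k in sequentially. norm (avg (A k) (\<lambda>a. (R k a)\<^sup>2) / V k) \<le> C / (4 * c) * (1 / real k)"
      using q_ev by eventually_elim (simp add: avg_def sum_nonneg)
  qed
  then have small: "\<forall>\<^sub>F k in sequentially. avg (A k) (\<lambda>a. (R k a)\<^sup>2) / V k < 1"
    and lim_sqrt: "(\<lambda>k. 2 * \<bar>t\<bar> * sqrt (avg (A k) (\<lambda>a. (R k a)\<^sup>2) / V k)) \<longlonglongrightarrow> 0"
  proof -
    assume *: "(\<lambda>k. avg (A k) (\<lambda>a. (R k a)\<^sup>2) / V k) \<longlonglongrightarrow> 0"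
    show "\<forall>\<^sub>F k in sequentially. avg (A k) (\<lambda>a. (R k a)\<^sup>2) / V k < 1"
      using * by (rule order_tendstoD) simp
    show "(\<lambda>k. 2 * \<bar>t\<bar> * sqrt (avg (A k) (\<lambda>a. (R k a)\<^sup>2) / V k)) \<longlonglongrightarrow> 0"
      using tendsto_mult_right_zero[OF tendsto_real_sqrt[OF *, simplified]] .
  qed
  have decomp: "S k a = X k a - R k a + (avg (A k) (lin_stat (g k) k) + (m k)\<^sup>2 / 2)" for k a
  proof -
    define l where "l = (\<Sum>i=1..k. real (a i))"
    have l: "L k a = l" "real (\<Sum>i=1..k. a i) = l" by (simp_all add: L_def lin_stat_def l_def)
    have "lin_stat (g k) k a = (\<Sum>i=1..k. real i * real (a i) + real (Suc k) * (real (a i) * (real (a i) - 1) / 2))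
        - (m k - 1 / 2) * l"
      by (simp add: lin_stat_def g_def l_def sum_subtractf sum_distrib_left)
    then show ?thesis
      unfolding S_def core_stat_def X_def R_def l by (simp add: power2_eq_square field_simps)
  qed
  have "(\<lambda>k. avg (A k) (\<lambda>a. iexp (t * ((S k a - avg (A k) (S k)) /
        sqrt (avg (A k) (\<lambda>a. (S k a - avg (A k) (S k))\<^sup>2)))))
      - avg (A k) (\<lambda>a. iexp (t * (X k a / sqrt (V k))))) \<longlonglongrightarrow> 0"
  proof (rule Lim_null_comparison[OF _ lim_sqrt])
    show "\<forall>\<^sub>F k in sequentially. cmod (avg (A k) (\<lambda>a. iexp (t * ((S k a - avg (A k) (S k)) /
        sqrt (avg (A k) (\<lambda>a. (S k a - avg (A k) (S k))\<^sup>2)))))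
      - avg (A k) (\<lambda>a. iexp (t * (X k a / sqrt (V k))))) \<le> 2 * \<bar>t\<bar> * sqrt (avg (A k) (\<lambda>a. (R k a)\<^sup>2) / V k)"
      using q_ev small
    proof eventually_elim
      case (elim k)
      show ?case
      proof (rule avg_iexp_standardized_diff_le[OF A(1,2)])
        show "avg (A k) (X k) = 0"
          unfolding X_def avg_def sum_subtractf using A(3)[of k] by simp
        show "avg (A k) (\<lambda>a. (X k a)\<^sup>2) = V k" by (simp only: V_def)
        show "0 < V k" "avg (A k) (\<lambda>a. (R k a)\<^sup>2) / V k < 1" using elim by auto
      qed (rule decomp)
    qed
  qed
  from tendsto_add[OF this clt] show ?thesis by simp
qed

lemma avg_reindex_bij_betw:
  assumes "bij_betw \<phi> A B"
  shows "avg B f = avg A (\<lambda>a. f (\<phi> a))"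
  using sum.reindex_bij_betw[OF assms, of f] bij_betw_same_card[OF assms] by (simp add: avg_def)

theorem corollary1p3:
  fixes d :: nat
  assumes "d \<ge> 3"
  shows "asymptotically_normal (\<lambda>n. random_strict_core n (d * n + 1)) (\<lambda>n xs. real (sum_list xs))"
  unfolding random_strict_core_def
proof (rule asymptotically_normal_pmf_of_set)
  define B where "B = (\<lambda>n. strict_cores n (d * n + 1))"
  \<comment> \<open>The encoding requires \<open>n \<ge> 1\<close>; all limits are therefore taken along \<open>n = Suc k\<close>.\<close>
  have "\<exists>\<phi>. bij_betw \<phi> (sparse_seqs d k) (B (Suc k)) \<and>
      (\<forall>a\<in>sparse_seqs d k. real (sum_list (\<phi> a)) = core_stat k a)" for k
    unfolding B_def by (rule strict_cores_encoding[of d k]) blast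
  then obtain \<phi> where \<phi>: "\<And>k. bij_betw (\<phi> k) (sparse_seqs d k) (B (Suc k))"
    "\<And>k a. a \<in> sparse_seqs d k \<Longrightarrow> real (sum_list (\<phi> k a)) = core_stat k a"
    by metis
  have "finite (B n) \<and> B n \<noteq> {}" if pos: "0 < n" for n
  proof -
    obtain k where n: "n = Suc k" using pos by (cases n) auto
    have "B n = \<phi> k ` sparse_seqs d k" using \<phi>(1)[of k] by (simp add: n bij_betw_def)
    then show ?thesis by simp
  qed
  then show "\<forall>\<^sub>F n in sequentially. finite (strict_cores n (d * n + 1)) \<and> strict_cores n (d * n + 1) \<noteq> {}"
    unfolding B_def using eventually_gt_at_top[of 0] by (rule eventually_mono[rotated])
  fix t :: real
  define F where "F = (\<lambda>n. avg (B n) (\<lambda>xs. iexp (t * ((real (sum_list xs) - avg (B n) (\<lambda>xs. real (sum_list xs))) /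
        sqrt (avg (B n) (\<lambda>xs. (real (sum_list xs) - avg (B n) (\<lambda>xs. real (sum_list xs)))\<^sup>2))))))"
  have "F (Suc k) = avg (sparse_seqs d k) (\<lambda>a. iexp (t * ((core_stat k a - avg (sparse_seqs d k) (core_stat k)) /
        sqrt (avg (sparse_seqs d k) (\<lambda>a. (core_stat k a - avg (sparse_seqs d k) (core_stat k))\<^sup>2)))))" for k
  proof -
    have mean: "avg (B (Suc k)) (\<lambda>xs. real (sum_list xs)) = avg (sparse_seqs d k) (core_stat k)"
      unfolding avg_reindex_bij_betw[OF \<phi>(1)] by (rule avg_cong) (rule \<phi>(2))
    show ?thesis
      unfolding F_def mean unfolding avg_reindex_bij_betw[OF \<phi>(1)]
      using \<phi>(2) by (simp cong: avg_cong)
  qed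
  then have "(\<lambda>k. F (Suc k)) \<longlonglongrightarrow> of_real (exp (- (t\<^sup>2) / 2))"
    using core_stat_char_limit[OF assms, of t] by simp
  then show "(\<lambda>n. avg (strict_cores n (d * n + 1)) (\<lambda>xs. iexp (t * ((real (sum_list xs) - avg (strict_cores n (d * n + 1)) (\<lambda>xs. real (sum_list xs))) /
        sqrt (avg (strict_cores n (d * n + 1)) (\<lambda>xs. (real (sum_list xs) - avg (strict_cores n (d * n + 1)) (\<lambda>xs. real (sum_list xs)))\<^sup>2))))))
      \<longlonglongrightarrow> of_real (exp (- (t\<^sup>2) / 2))"
    unfolding F_def B_def by (rule LIMSEQ_imp_Suc)
qed

end
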